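(* Let $\psi\colon S\to M$ be a codimension-two spacelike submanifold in a spacetime $(M,g)$ of dimension $n+2\ge4$ that admits an umbilical lightlike normal section. Then $$\tau_{\mathrm{ext}}=g(\mathbf H,\mathbf H).$$ Moreover, if $M$ has constant sectional curvature $c$, then the scalar curvature of $S$ satisfies $$\mathrm{Scal}=n(n-1)\bigl(c+g(\mathbf H,\mathbf H)\bigr).$$
   Context: A spacetime $(M,g)$ is a connected time-oriented Lorentzian manifold of signature $(-,+,\dots,+)$. A vector $v$ is lightlike if $g(v,v)=0$ and $v\ne0$. A codimension-two spacelike submanifold $\psi\colon S\to M$ is an immersion of a connected $n$-manifold whose induced metric (also denoted $g$) is Riemannian. $\mathrm{II}$ is the second fundamental form, $A_\zeta$ is the shape operator of a normal field $\zeta$, with $g(A_\zeta X,Y)=g(\mathrm{II}(X,Y),\zeta)$, and $\mathbf H=\frac1n\operatorname{trace}_g\mathrm{II}$ is the mean curvature vector. An umbilical lightlike normal section is a globally defined lightlike normal vector field $\xi$ with $A_\xi=\rho I$ for some function $\rho$ on $S$. For $p\in S$ and a plane $\Pi\subset T_pS$, the discriminant is $\mathscr D_p(\Pi)=\mathscr K(\Pi)-\widetilde{\mathscr K}(\Pi)$, where $\mathscr K$ and $\widetilde{\mathscr K}$ are the sectional curvatures of $S$ and $M$. The extrinsic scalar curvature is $$\tau_{\mathrm{ext}}=\frac{2}{n(n-1)}\sum_{i<j}\mathscr D(\Pi_{ij}),\qquad \Pi_{ij}=\mathrm{span}\{E_i,E_j\},$$ for a local orthonormal frame $\{E_1,\dots,E_n\}$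 of $S$. *)

theory Defs
  imports "HOL-Analysis.Analysis"
begin

section \<open>Smooth manifolds\<close>

text \<open>For open \<open>S\<close> this is \<open>C\<^sup>k\<close> in the usual sense: on a finite-dimensional domain it suffices to
  iterate directional derivatives.\<close>

primrec Ck_on :: "nat \<Rightarrow> 'a::euclidean_space set \<Rightarrow> ('a \<Rightarrow> 'b::real_normed_vector) \<Rightarrow> bool" where
  "Ck_on 0 S f \<longleftrightarrow> continuous_on S f"
| "Ck_on (Suc k) S f \<longleftrightarrow>
    (\<forall>x\<in>S. f differentiable (at x)) \<and> (\<forall>v. Ck_on k S (\<lambda>x. frechet_derivative f (at x) v))"

definition smooth_on :: "'a::euclidean_space set \<Rightarrow> ('a \<Rightarrow> 'b::real_normed_vector) \<Rightarrow> bool" where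
  "smooth_on S f \<longleftrightarrow> (\<forall>k. Ck_on k S f)"

text \<open>A chart is a pair of a domain and a coordinate map (whose values off the domain are
  irrelevant). The manifold is the whole type; its dimension is the dimension of the model space.\<close>

type_synonym ('a, 'e) chart = "'a set \<times> ('a \<Rightarrow> 'e)"

definition chart_inv :: "('a, 'e) chart \<Rightarrow> 'e \<Rightarrow> 'a" where
  "chart_inv c = inv_into (fst c) (snd c)"

definition smooth_atlas ::
    "('a::{t2_space,second_countable_topology}, 'e::euclidean_space) chart set \<Rightarrow> bool" where
  "smooth_atlas A \<longleftrightarrow>
    (\<forall>c\<in>A. open (fst c) \<and> open (snd c ` fst c) \<and>
       homeomorphism (fst c) (snd c ` fst c) (snd c) (chart_inv c)) \<and>
    (\<Union>c\<in>A. fst c) = UNIV \<and>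
    (\<forall>c\<in>A. \<forall>d\<in>A. smooth_on (snd c ` (fst c \<inter> fst d)) (snd d \<circ> chart_inv c))"

text \<open>The tangent space at \<open>p\<close> is the model space: a tangent vector is given by its components in the
  preferred chart \<open>chart_at A p\<close>. The components at \<open>p\<close> in another chart are obtained by
  \<open>coord_change\<close>, the derivative of the transition map.\<close>

definition chart_at :: "('a, 'e) chart set \<Rightarrow> 'a \<Rightarrow> ('a, 'e) chart" where
  "chart_at A p = (SOME c. c \<in> A \<and> p \<in> fst c)"

definition coord_change ::
    "('a, 'e::euclidean_space) chart \<Rightarrow> ('a, 'e) chart \<Rightarrow> 'a \<Rightarrow> 'e \<Rightarrow> 'e" where
  "coord_change c d p u = frechet_derivative (snd d \<circ> chart_inv c) (at (snd c p)) u"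

definition smooth_map ::
    "('a::topological_space, 'd::euclidean_space) chart set \<Rightarrow>
     ('b::topological_space, 'e::euclidean_space) chart set \<Rightarrow> ('a \<Rightarrow> 'b) \<Rightarrow> bool" where
  "smooth_map A B \<psi> \<longleftrightarrow> continuous_on UNIV \<psi> \<and>
    (\<forall>c\<in>A. \<forall>d\<in>B. smooth_on (snd c ` (fst c \<inter> \<psi> -` fst d)) (snd d \<circ> \<psi> \<circ> chart_inv c))"

definition differential ::
    "('a, 'd::euclidean_space) chart set \<Rightarrow> ('b, 'e::euclidean_space) chart set \<Rightarrow>
     ('a \<Rightarrow> 'b) \<Rightarrow> 'a \<Rightarrow> 'd \<Rightarrow> 'e" where
  "differential A B \<psi> p u = frechet_derivative
     (snd (chart_at B (\<psi> p)) \<circ> \<psi> \<circ> chart_inv (chart_at A p)) (at (snd (chart_at A p) p)) u"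

definition immersion ::
    "('a::topological_space, 'd::euclidean_space) chart set \<Rightarrow>
     ('b::topological_space, 'e::euclidean_space) chart set \<Rightarrow> ('a \<Rightarrow> 'b) \<Rightarrow> bool" where
  "immersion A B \<psi> \<longleftrightarrow> smooth_map A B \<psi> \<and> (\<forall>p. inj (differential A B \<psi> p))"

text \<open>A vector field along \<open>\<psi>\<close> assigns to \<open>p\<close> a tangent vector at \<open>\<psi> p\<close>; vector fields on a manifold
  are the case \<open>\<psi> = id\<close>.\<close>

definition field_in ::
    "('b, 'e::euclidean_space) chart set \<Rightarrow> ('a \<Rightarrow> 'b) \<Rightarrow> ('a, 'd) chart \<Rightarrow> ('b, 'e) chart \<Rightarrow>
     ('a \<Rightarrow> 'e) \<Rightarrow> 'd \<Rightarrow> 'e" where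
  "field_in B \<psi> c d W x =
    (let p = chart_inv c x in coord_change (chart_at B (\<psi> p)) d (\<psi> p) (W p))"

definition smooth_field_along ::
    "('a, 'd::euclidean_space) chart set \<Rightarrow> ('b, 'e::euclidean_space) chart set \<Rightarrow>
     ('a \<Rightarrow> 'b) \<Rightarrow> ('a \<Rightarrow> 'e) \<Rightarrow> bool" where
  "smooth_field_along A B \<psi> W \<longleftrightarrow>
    (\<forall>c\<in>A. \<forall>d\<in>B. smooth_on (snd c ` (fst c \<inter> \<psi> -` fst d)) (field_in B \<psi> c d W))"

abbreviation smooth_vector_field ::
    "('a, 'e::euclidean_space) chart set \<Rightarrow> ('a \<Rightarrow> 'e) \<Rightarrow> bool" where
  "smooth_vector_field A X \<equiv> smooth_field_along A A id X"


section \<open>Metrics and spacetimes\<close>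

type_synonym ('a, 'e) metric = "'a \<Rightarrow> 'e \<Rightarrow> 'e \<Rightarrow> real"

definition metric_in ::
    "('a, 'e::euclidean_space) chart set \<Rightarrow> ('a, 'e) metric \<Rightarrow> ('a, 'e) chart \<Rightarrow>
     'e \<Rightarrow> 'e \<Rightarrow> 'e \<Rightarrow> real" where
  "metric_in A g c x u v =
    (let p = chart_inv c x; \<tau> = coord_change c (chart_at A p) p in g p (\<tau> u) (\<tau> v))"

definition smooth_symmetric_tensor ::
    "('a, 'e::euclidean_space) chart set \<Rightarrow> ('a, 'e) metric \<Rightarrow> bool" where
  "smooth_symmetric_tensor A g \<longleftrightarrow>
    (\<forall>p. bilinear (g p) \<and> (\<forall>u v. g p u v = g p v u)) \<and>
    (\<forall>c\<in>A. \<forall>u v. smooth_on (snd c ` fst c) (\<lambda>x. metric_in A g c x u v))"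

definition riemannian_metric ::
    "('a, 'e::euclidean_space) chart set \<Rightarrow> ('a, 'e) metric \<Rightarrow> bool" where
  "riemannian_metric A g \<longleftrightarrow>
    smooth_symmetric_tensor A g \<and> (\<forall>p u. u \<noteq> 0 \<longrightarrow> g p u u > 0)"

definition lorentzian_metric ::
    "('a, 'e::euclidean_space) chart set \<Rightarrow> ('a, 'e) metric \<Rightarrow> bool" where
  "lorentzian_metric A g \<longleftrightarrow> smooth_symmetric_tensor A g \<and>
    (\<forall>p. \<exists>E :: nat \<Rightarrow> 'e. \<forall>i<DIM('e). \<forall>j<DIM('e).
       g p (E i) (E j) = (if i \<noteq> j then 0 else if i = 0 then -1 else 1))"

text \<open>A time orientation is represented by a globally defined smooth timelike vector field \<open>T\<close>.\<close>

definition spacetime ::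
    "('a::{t2_space,second_countable_topology}, 'e::euclidean_space) chart set \<Rightarrow>
     ('a, 'e) metric \<Rightarrow> ('a \<Rightarrow> 'e) \<Rightarrow> bool" where
  "spacetime A g T \<longleftrightarrow> smooth_atlas A \<and> connected (UNIV :: 'a set) \<and> lorentzian_metric A g \<and>
    smooth_vector_field A T \<and> (\<forall>p. g p (T p) (T p) < 0)"


section \<open>Levi-Civita connection and curvature\<close>

text \<open>\<open>christoffel A g c x u v\<close> is the covariant derivative of the coordinate field with constant
  components \<open>v\<close> in direction \<open>u\<close>, in components of the chart \<open>c\<close> at the point with coordinates
  \<open>x\<close>; the condition is the Koszul formula for coordinate fields.\<close>

definition christoffel ::
    "('a, 'e::euclidean_space) chart set \<Rightarrow> ('a, 'e) metric \<Rightarrow> ('a, 'e) chart \<Rightarrow>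
     'e \<Rightarrow> 'e \<Rightarrow> 'e \<Rightarrow> 'e" where
  "christoffel A g c x u v = (THE w. \<forall>z.
     2 * metric_in A g c x w z =
       frechet_derivative (\<lambda>y. metric_in A g c y v z) (at x) u +
       frechet_derivative (\<lambda>y. metric_in A g c y u z) (at x) v -
       frechet_derivative (\<lambda>y. metric_in A g c y u v) (at x) z)"

text \<open>Sign convention: \<open>R(U,V)W = \<nabla>\<^sub>U\<nabla>\<^sub>V W - \<nabla>\<^sub>V\<nabla>\<^sub>U W - \<nabla>\<^bsub>[U,V]\<^esub> W\<close>, evaluated on coordinate fields of
  the preferred chart at \<open>p\<close> (whose brackets vanish).\<close>

definition curvature_tensor ::
    "('a, 'e::euclidean_space) chart set \<Rightarrow> ('a, 'e) metric \<Rightarrow> 'a \<Rightarrow> 'e \<Rightarrow> 'e \<Rightarrow> 'e \<Rightarrow> 'e" where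
  "curvature_tensor A g p u v w =
    (let c = chart_at A p; x = snd c p; \<Gamma> = christoffel A g c in
       frechet_derivative (\<lambda>y. \<Gamma> y v w) (at x) u - frechet_derivative (\<lambda>y. \<Gamma> y u w) (at x) v +
       \<Gamma> x u (\<Gamma> x v w) - \<Gamma> x v (\<Gamma> x u w))"

definition tangent_plane :: "'e::euclidean_space set \<Rightarrow> bool" where
  "tangent_plane P \<longleftrightarrow> subspace P \<and> dim P = 2"

definition nondegenerate_on :: "('e \<Rightarrow> 'e \<Rightarrow> real) \<Rightarrow> 'e::euclidean_space set \<Rightarrow> bool" where
  "nondegenerate_on b P \<longleftrightarrow> (\<forall>u\<in>P. (\<forall>v\<in>P. b u v = 0) \<longrightarrow> u = 0)"

text \<open>Meaningful for nondegenerate planes; the quotient does not depend on the basis of the plane.\<close>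

definition sectional_curvature ::
    "('a, 'e::euclidean_space) chart set \<Rightarrow> ('a, 'e) metric \<Rightarrow> 'a \<Rightarrow> 'e set \<Rightarrow> real" where
  "sectional_curvature A g p P = (THE k. \<forall>u v. span {u, v} = P \<longrightarrow>
     k = g p (curvature_tensor A g p u v v) u / (g p u u * g p v v - (g p u v)\<^sup>2))"

definition constant_sectional_curvature ::
    "('a, 'e::euclidean_space) chart set \<Rightarrow> ('a, 'e) metric \<Rightarrow> real \<Rightarrow> bool" where
  "constant_sectional_curvature A g c \<longleftrightarrow>
    (\<forall>p P. tangent_plane P \<and> nondegenerate_on (g p) P \<longrightarrow> sectional_curvature A g p P = c)"

definition orthonormal_frame :: "('e \<Rightarrow> 'e \<Rightarrow> real) \<Rightarrow> (nat \<Rightarrow> 'e::euclidean_space) \<Rightarrow> bool" where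
  "orthonormal_frame h E \<longleftrightarrow>
    (\<forall>i<DIM('e). \<forall>j<DIM('e). h (E i) (E j) = (if i = j then 1 else 0))"

text \<open>Trace of a (possibly vector-valued) bilinear map \<open>b\<close> with respect to a positive definite \<open>h\<close>.\<close>

definition metric_trace ::
    "('e \<Rightarrow> 'e \<Rightarrow> real) \<Rightarrow> ('e::euclidean_space \<Rightarrow> 'e \<Rightarrow> 'v::real_vector) \<Rightarrow> 'v" where
  "metric_trace h b =
    (THE t. \<forall>E. orthonormal_frame h E \<longrightarrow> t = (\<Sum>i<DIM('e). b (E i) (E i)))"

definition ricci_tensor ::
    "('a, 'e::euclidean_space) chart set \<Rightarrow> ('a, 'e) metric \<Rightarrow> 'a \<Rightarrow> 'e \<Rightarrow> 'e \<Rightarrow> real" where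
  "ricci_tensor A g p v w = (\<Sum>b\<in>Basis. curvature_tensor A g p b v w \<bullet> b)"

definition scalar_curvature ::
    "('a, 'e::euclidean_space) chart set \<Rightarrow> ('a, 'e) metric \<Rightarrow> 'a \<Rightarrow> real" where
  "scalar_curvature A h p = metric_trace (h p) (ricci_tensor A h p)"


section \<open>Spacelike submanifolds\<close>

definition induced_metric ::
    "('s, 'd::euclidean_space) chart set \<Rightarrow> ('m, 'e::euclidean_space) chart set \<Rightarrow>
     ('m, 'e) metric \<Rightarrow> ('s \<Rightarrow> 'm) \<Rightarrow> ('s, 'd) metric" where
  "induced_metric A B g \<psi> p u v = g (\<psi> p) (differential A B \<psi> p u) (differential A B \<psi> p v)"

definition spacelike_submanifold ::
    "('s::{t2_space,second_countable_topology}, 'd::euclidean_space) chart set \<Rightarrow>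
     ('m::{t2_space,second_countable_topology}, 'e::euclidean_space) chart set \<Rightarrow>
     ('m, 'e) metric \<Rightarrow> ('s \<Rightarrow> 'm) \<Rightarrow> bool" where
  "spacelike_submanifold A B g \<psi> \<longleftrightarrow> smooth_atlas A \<and> connected (UNIV :: 's set) \<and>
    immersion A B \<psi> \<and> riemannian_metric A (induced_metric A B g \<psi>)"

text \<open>The induced covariant derivative at \<open>p\<close>, in direction \<open>u\<close>, of a field \<open>W\<close> along \<open>\<psi>\<close>.\<close>

definition cov_deriv_along ::
    "('s, 'd::euclidean_space) chart set \<Rightarrow> ('m, 'e::euclidean_space) chart set \<Rightarrow>
     ('m, 'e) metric \<Rightarrow> ('s \<Rightarrow> 'm) \<Rightarrow> 's \<Rightarrow> 'd \<Rightarrow> ('s \<Rightarrow> 'e) \<Rightarrow> 'e" where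
  "cov_deriv_along A B g \<psi> p u W =
    (let c = chart_at A p; d = chart_at B (\<psi> p) in
       frechet_derivative (field_in B \<psi> c d W) (at (snd c p)) u +
       christoffel B g d (snd d (\<psi> p)) (differential A B \<psi> p u) (W p))"

definition normal_space ::
    "('s, 'd::euclidean_space) chart set \<Rightarrow> ('m, 'e::euclidean_space) chart set \<Rightarrow>
     ('m, 'e) metric \<Rightarrow> ('s \<Rightarrow> 'm) \<Rightarrow> 's \<Rightarrow> 'e set" where
  "normal_space A B g \<psi> p = {w. \<forall>u. g (\<psi> p) w (differential A B \<psi> p u) = 0}"

definition normal_part ::
    "('s, 'd::euclidean_space) chart set \<Rightarrow> ('m, 'e::euclidean_space) chart set \<Rightarrow>
     ('m, 'e) metric \<Rightarrow> ('s \<Rightarrow> 'm) \<Rightarrow> 's \<Rightarrow> 'e \<Rightarrow> 'e" where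
  "normal_part A B g \<psi> p w =
    (THE z. z \<in> normal_space A B g \<psi> p \<and> w - z \<in> range (differential A B \<psi> p))"

text \<open>\<open>II(u,v)\<close> is the normal part of the covariant derivative in direction \<open>u\<close> of a local tangent field
  extending \<open>v\<close>. It is independent of the extension; the one used here has constant components in the
  preferred chart at \<open>p\<close> and is defined on the domain of that chart.\<close>

definition coord_extension ::
    "('a, 'e::euclidean_space) chart set \<Rightarrow> 'a \<Rightarrow> 'e \<Rightarrow> 'a \<Rightarrow> 'e" where
  "coord_extension A p v q = coord_change (chart_at A p) (chart_at A q) q v"

definition second_fundamental_form ::
    "('s, 'd::euclidean_space) chart set \<Rightarrow> ('m, 'e::euclidean_space) chart set \<Rightarrow>
     ('m, 'e) metric \<Rightarrow> ('s \<Rightarrow> 'm) \<Rightarrow> 's \<Rightarrow> 'd \<Rightarrow> 'd \<Rightarrow> 'e" where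
  "second_fundamental_form A B g \<psi> p u v = normal_part A B g \<psi> p
     (cov_deriv_along A B g \<psi> p u (\<lambda>q. differential A B \<psi> q (coord_extension A p v q)))"

definition mean_curvature ::
    "('s, 'd::euclidean_space) chart set \<Rightarrow> ('m, 'e::euclidean_space) chart set \<Rightarrow>
     ('m, 'e) metric \<Rightarrow> ('s \<Rightarrow> 'm) \<Rightarrow> 's \<Rightarrow> 'e" where
  "mean_curvature A B g \<psi> p = (1 / real DIM('d)) *\<^sub>R
     metric_trace (induced_metric A B g \<psi> p) (second_fundamental_form A B g \<psi> p)"

definition shape_operator ::
    "('s, 'd::euclidean_space) chart set \<Rightarrow> ('m, 'e::euclidean_space) chart set \<Rightarrow>
     ('m, 'e) metric \<Rightarrow> ('s \<Rightarrow> 'm) \<Rightarrow> ('s \<Rightarrow> 'e) \<Rightarrow> 's \<Rightarrow> 'd \<Rightarrow> 'd" where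
  "shape_operator A B g \<psi> \<zeta> p u = (THE w. \<forall>v.
     induced_metric A B g \<psi> p w v = g (\<psi> p) (second_fundamental_form A B g \<psi> p u v) (\<zeta> p))"

definition umbilical_lightlike_section ::
    "('s, 'd::euclidean_space) chart set \<Rightarrow> ('m, 'e::euclidean_space) chart set \<Rightarrow>
     ('m, 'e) metric \<Rightarrow> ('s \<Rightarrow> 'm) \<Rightarrow> ('s \<Rightarrow> 'e) \<Rightarrow> bool" where
  "umbilical_lightlike_section A B g \<psi> \<xi> \<longleftrightarrow>
    smooth_field_along A B \<psi> \<xi> \<and>
    (\<forall>p. \<xi> p \<in> normal_space A B g \<psi> p \<and> g (\<psi> p) (\<xi> p) (\<xi> p) = 0 \<and> \<xi> p \<noteq> 0) \<and>
    (\<exists>\<rho> :: 's \<Rightarrow> real. \<forall>p u. shape_operator A B g \<psi> \<xi> p u = \<rho> p *\<^sub>R u)"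

definition discriminant ::
    "('s, 'd::euclidean_space) chart set \<Rightarrow> ('m, 'e::euclidean_space) chart set \<Rightarrow>
     ('m, 'e) metric \<Rightarrow> ('s \<Rightarrow> 'm) \<Rightarrow> 's \<Rightarrow> 'd set \<Rightarrow> real" where
  "discriminant A B g \<psi> p P = sectional_curvature A (induced_metric A B g \<psi>) p P -
     sectional_curvature B g (\<psi> p) (differential A B \<psi> p ` P)"

text \<open>Frames are indexed from \<open>0\<close>. The value at \<open>p\<close> only involves the frame at \<open>p\<close>, and it is the
  same for every orthonormal frame.\<close>

definition extrinsic_scalar_curvature ::
    "('s, 'd::euclidean_space) chart set \<Rightarrow> ('m, 'e::euclidean_space) chart set \<Rightarrow>
     ('m, 'e) metric \<Rightarrow> ('s \<Rightarrow> 'm) \<Rightarrow> 's \<Rightarrow> real" where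
  "extrinsic_scalar_curvature A B g \<psi> p =
    (THE t. \<forall>E. orthonormal_frame (induced_metric A B g \<psi> p) E \<longrightarrow>
       t = 2 / (real DIM('d) * (real DIM('d) - 1)) *
           (\<Sum>j<DIM('d). \<Sum>i<j. discriminant A B g \<psi> p (span {E i, E j})))"

end

theory Submission
  imports Defs
begin

text \<open>In coordinates write \<open>f\<close> for the immersion, \<open>F = Df\<close>, \<open>G\<close> for the ambient metric and \<open>h = G(F,F)\<close>. With
  \<open>S(u,v) = D\<^sup>2f(u,v) + \<Gamma>(Fu,Fv)\<close>, the lowered Christoffel symbols of \<open>h\<close> are \<open>G(S(u,v),Fz)\<close>; differentiating
  this identity once more, the symmetric third derivatives of \<open>f\<close> cancel in the alternation and the Gauss
  equation remains. A normal vector orthogonal to a lightlike normal \<open>\<xi>\<close> is a multiple of \<open>\<xi>\<close>, because the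
  codimension is two and the ambient metric is nondegenerate. Hence \<open>A\<^sub>\<xi> = \<rho>I\<close> forces
  \<open>II = h \<otimes> H + a \<otimes> \<xi>\<close> with \<open>a\<close> traceless, and since \<open>g(\<xi>,\<xi>) = 0\<close> the quadratic terms of the Gauss equation,
  summed over an orthonormal frame, leave only \<open>n(n-1) g(H,H)\<close>.\<close>

section \<open>Calculus\<close>

text \<open>A tangent vector is a coordinate vector in the chart that \<open>chart_at\<close> picks
  at its base point. This choice may jump from point to point, so such components cannot be
  differentiated directly. The calculus is therefore done for metrics on open subsets of Euclidean
  spaces, read in one fixed pair of charts; at the base point of its own preferred chart
  \<open>coord_change\<close> is the identity, so the local identity there is already the global
  one. The connection, the normal part, the shape operator, the traces and the sectional curvature
  are all \<open>THE\<close> descriptions: each needs existence and uniqueness before it can be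
  computed. The connection must moreover be differentiable, and this is read off from the linear
  system that it solves. As for the factor n(n-1): over an orthonormal frame the products
  g(II(e_i,e_i), II(e_j,e_j)) add up to n^2 g(H,H), while the squares of II(e_i,e_j) add up to n
  g(H,H) + 2 \<rho> tr a with \<rho> = g(H,\<xi>) and tr a = 0.\<close>

lemma second_difference_mean_value:
  fixes f :: "'a::real_normed_vector \<Rightarrow> real"
  assumes f: "\<And>y. y \<in> ball x e \<Longrightarrow> (f has_derivative f' y) (at y)"
    and f': "\<And>y. y \<in> ball x e \<Longrightarrow> ((\<lambda>y. f' y u) has_derivative f'' y) (at y)"
    and t: "0 < t" "t * (norm u + norm v) < e"
  obtains s r where "0 < s" "s < t" "0 < r" "r < t"
    "f (x + t *\<^sub>R u + t *\<^sub>R v) - f (x + t *\<^sub>R u) - f (x + t *\<^sub>R v) + f x =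
      t\<^sup>2 * f'' (x + s *\<^sub>R u + r *\<^sub>R v) v"
proof -
  have inball: "x + s *\<^sub>R u + r *\<^sub>R v \<in> ball x e" if "0 \<le> s" "s \<le> t" "0 \<le> r" "r \<le> t" for s r
  proof -
    have "norm (s *\<^sub>R u + r *\<^sub>R v) \<le> s * norm u + r * norm v"
      using that norm_triangle_ineq[of "s *\<^sub>R u" "r *\<^sub>R v"] by simp
    also have "\<dots> \<le> t * norm u + t * norm v"
      using that by (intro add_mono mult_right_mono) auto
    finally show ?thesis using t by (simp add: dist_norm add.assoc algebra_simps norm_minus_commute)
  qed
  \<comment> \<open>The second difference is the increment of \<open>\<phi>\<close> over [0,t]. The
    mean value theorem in \<open>s\<close> leaves a difference of first derivatives, which is the
    increment of \<open>\<theta>\<close> below; a second application in \<open>r\<close> gives a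
    second derivative at an intermediate point.\<close>
  define \<phi> where "\<phi> = (\<lambda>s. f (x + s *\<^sub>R u + t *\<^sub>R v) - f (x + s *\<^sub>R u))"
  have d1: "(\<phi> has_derivative
      (\<lambda>h. h * (f' (x + s *\<^sub>R u + t *\<^sub>R v) u - f' (x + s *\<^sub>R u) u))) (at s)"
    if s: "0 \<le> s" "s \<le> t" for s
  proof -
    have b1: "x + s *\<^sub>R u + t *\<^sub>R v \<in> ball x e" and b2: "x + s *\<^sub>R u \<in> ball x e"
      using inball[of s t] inball[of s 0] s t by auto
    have "((\<lambda>s. f (x + s *\<^sub>R u + t *\<^sub>R v)) has_derivative
        (\<lambda>h. f' (x + s *\<^sub>R u + t *\<^sub>R v) (h *\<^sub>R u))) (at s)"
      by (rule has_derivative_compose[of "\<lambda>s. x + s *\<^sub>R u + t *\<^sub>R v" "\<lambda>h. h *\<^sub>R u", OF _ f[OF b1]])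
        (auto intro!: derivative_eq_intros)
    moreover have "((\<lambda>s. f (x + s *\<^sub>R u)) has_derivative
        (\<lambda>h. f' (x + s *\<^sub>R u) (h *\<^sub>R u))) (at s)"
      by (rule has_derivative_compose[of "\<lambda>s. x + s *\<^sub>R u" "\<lambda>h. h *\<^sub>R u", OF _ f[OF b2]])
        (auto intro!: derivative_eq_intros)
    ultimately have "(\<phi> has_derivative (\<lambda>h. f' (x + s *\<^sub>R u + t *\<^sub>R v) (h *\<^sub>R u) -
        f' (x + s *\<^sub>R u) (h *\<^sub>R u))) (at s)"
      unfolding \<phi>_def by (rule has_derivative_diff)
    then show ?thesis
      using linear_cmul[OF has_derivative_linear[OF f[OF b1]]]
        linear_cmul[OF has_derivative_linear[OF f[OF b2]]]
      by (simp add: right_diff_distrib)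
  qed
  obtain s where s: "0 < s" "s < t" and
    e1: "\<phi> t - \<phi> 0 = t * (f' (x + s *\<^sub>R u + t *\<^sub>R v) u - f' (x + s *\<^sub>R u) u)"
  proof -
    have "\<exists>s\<in>{0<..<t}. \<phi> t - \<phi> 0 =
        (t - 0) * (f' (x + s *\<^sub>R u + t *\<^sub>R v) u - f' (x + s *\<^sub>R u) u)"
      by (rule mvt[OF t(1)])
        (auto intro!: has_derivative_continuous_on has_derivative_at_withinI[OF d1] d1)
    then show ?thesis using that by auto
  qed
  define \<theta> where "\<theta> = (\<lambda>r. f' (x + s *\<^sub>R u + r *\<^sub>R v) u)"
  have d2: "(\<theta> has_derivative (\<lambda>h. h * f'' (x + s *\<^sub>R u + r *\<^sub>R v) v)) (at r)"
    if r: "0 \<le> r" "r \<le> t" for r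
  proof -
    have b: "x + s *\<^sub>R u + r *\<^sub>R v \<in> ball x e"
      using inball[of s r] s r by auto
    have "(\<theta> has_derivative (\<lambda>h. f'' (x + s *\<^sub>R u + r *\<^sub>R v) (h *\<^sub>R v))) (at r)"
      unfolding \<theta>_def
      by (rule has_derivative_compose[of "\<lambda>r. x + s *\<^sub>R u + r *\<^sub>R v" "\<lambda>h. h *\<^sub>R v", OF _ f'[OF b]])
        (auto intro!: derivative_eq_intros)
    then show ?thesis
      using linear_cmul[OF has_derivative_linear[OF f'[OF b]]] by simp
  qed
  obtain r where r: "0 < r" "r < t" and e2: "\<theta> t - \<theta> 0 = t * f'' (x + s *\<^sub>R u + r *\<^sub>R v) v"
  proof -
    have "\<exists>r\<in>{0<..<t}. \<theta> t - \<theta> 0 = (t - 0) * f'' (x + s *\<^sub>R u + r *\<^sub>R v) v"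
      by (rule mvt[OF t(1)])
        (auto intro!: has_derivative_continuous_on has_derivative_at_withinI[OF d2] d2)
    then show ?thesis using that by auto
  qed
  have "f (x + t *\<^sub>R u + t *\<^sub>R v) - f (x + t *\<^sub>R u) - f (x + t *\<^sub>R v) + f x = \<phi> t - \<phi> 0"
    by (simp add: \<phi>_def)
  also have "\<dots> = t\<^sup>2 * f'' (x + s *\<^sub>R u + r *\<^sub>R v) v"
    using e1 e2 by (simp add: \<theta>_def power2_eq_square)
  finally show ?thesis using that s r by blast
qed

text \<open>The second difference does not depend on the order of \<open>u\<close> and
  \<open>v\<close>, so its two mean value formulas equate a value of \<open>fu'\<close> with a value
  of \<open>fv'\<close> at points near \<open>x\<close>, and continuity does the rest. The
  derivatives are taken with the first direction frozen because \<open>Ck_on\<close> provides them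
  in this form.\<close>

lemma second_derivative_symmetric_real:
  fixes f :: "'a::real_normed_vector \<Rightarrow> real"
  assumes "open U" "x \<in> U"
    and f: "\<And>y. y \<in> U \<Longrightarrow> (f has_derivative f' y) (at y)"
    and fu: "\<And>y. y \<in> U \<Longrightarrow> ((\<lambda>y. f' y u) has_derivative fu' y) (at y)"
    and fv: "\<And>y. y \<in> U \<Longrightarrow> ((\<lambda>y. f' y v) has_derivative fv' y) (at y)"
    and cu: "continuous_on U (\<lambda>y. fu' y v)" and cv: "continuous_on U (\<lambda>y. fv' y u)"
  shows "fu' x v = fv' x u"
proof (rule ccontr)
  assume "fu' x v \<noteq> fv' x u"
  define \<epsilon> where "\<epsilon> = \<bar>fu' x v - fv' x u\<bar> / 2"
  have \<epsilon>: "\<epsilon> > 0" using \<open>fu' x v \<noteq> fv' x u\<close> by (simp add: \<epsilon>_def)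
  have "isCont (\<lambda>y. fu' y v) x" "isCont (\<lambda>y. fv' y u) x"
    using cu cv assms(1,2) continuous_on_eq_continuous_at by blast+
  then obtain d1 d2 where d1: "d1 > 0" "\<And>y. dist y x < d1 \<Longrightarrow> \<bar>fu' y v - fu' x v\<bar> < \<epsilon>"
    and d2: "d2 > 0" "\<And>y. dist y x < d2 \<Longrightarrow> \<bar>fv' y u - fv' x u\<bar> < \<epsilon>"
    using \<epsilon> unfolding continuous_at_eps_delta dist_real_def by metis
  obtain d3 where d3: "d3 > 0" "ball x d3 \<subseteq> U"
    using assms(1,2) open_contains_ball by blast
  define e where "e = min d1 (min d2 d3)"
  have e: "e > 0" "e \<le> d1" "e \<le> d2" "ball x e \<subseteq> U" using d1 d2 d3 by (auto simp: e_def)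
  \<comment> \<open>The summand 1 keeps the divisor positive even for \<open>u = v = 0\<close> and
    makes \<open>t * (norm u + norm v)\<close> strictly smaller than \<open>e\<close>.\<close>
  define t where "t = e / (norm u + norm v + 1)"
  have pos: "norm u + norm v + 1 > 0"
    by (simp add: add_nonneg_pos)
  have t: "0 < t" using e pos by (simp add: t_def)
  have te: "t * (norm u + norm v + 1) = e" using pos by (simp add: t_def)
  have te': "t * (norm u + norm v) < e" "t * (norm v + norm u) < e"
    using te t by (simp_all add: algebra_simps)
  obtain s r where sr: "0 < s" "s < t" "0 < r" "r < t"
    "f (x + t *\<^sub>R u + t *\<^sub>R v) - f (x + t *\<^sub>R u) - f (x + t *\<^sub>R v) + f x =
      t\<^sup>2 * fu' (x + s *\<^sub>R u + r *\<^sub>R v) v"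
    by (rule second_difference_mean_value[of x e f f' u fu' t v]) (use f fu e t te' in auto)
  obtain s' r' where sr': "0 < s'" "s' < t" "0 < r'" "r' < t"
    "f (x + t *\<^sub>R v + t *\<^sub>R u) - f (x + t *\<^sub>R v) - f (x + t *\<^sub>R u) + f x =
      t\<^sup>2 * fv' (x + s' *\<^sub>R v + r' *\<^sub>R u) u"
    by (rule second_difference_mean_value[of x e f f' v fv' t u]) (use f fv e t te' in auto)
  have eq: "fu' (x + s *\<^sub>R u + r *\<^sub>R v) v = fv' (x + s' *\<^sub>R v + r' *\<^sub>R u) u"
  proof -
    have "t\<^sup>2 * fu' (x + s *\<^sub>R u + r *\<^sub>R v) v = t\<^sup>2 * fv' (x + s' *\<^sub>R v + r' *\<^sub>R u) u"
      unfolding sr(5)[symmetric] sr'(5)[symmetric] by (simp add: add.assoc add.commute[of "t *\<^sub>R u"])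
    then show ?thesis using t by simp
  qed
  have near: "dist (x + a *\<^sub>R y + b *\<^sub>R z) x < e"
    if "0 < a" "a < t" "0 < b" "b < t" "t * (norm y + norm z) < e" for a b y z
  proof -
    have "norm (a *\<^sub>R y + b *\<^sub>R z) \<le> a * norm y + b * norm z"
      using that norm_triangle_ineq[of "a *\<^sub>R y" "b *\<^sub>R z"] by simp
    also have "\<dots> \<le> t * norm y + t * norm z"
      using that by (intro add_mono mult_right_mono) auto
    finally show ?thesis using that by (simp add: dist_norm algebra_simps)
  qed
  have "\<bar>fu' (x + s *\<^sub>R u + r *\<^sub>R v) v - fu' x v\<bar> < \<epsilon>"
    using d1(2) near[OF sr(1-4) te'(1)] e by auto
  moreover have "\<bar>fv' (x + s' *\<^sub>R v + r' *\<^sub>R u) u - fv' x u\<bar> < \<epsilon>"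
    using d2(2) near[OF sr'(1-4) te'(2)] e by auto
  ultimately show False using eq unfolding \<epsilon>_def by (smt (verit) field_sum_of_halves)
qed

lemma Ck_on_Suc_imp: "Ck_on (Suc k) S f \<Longrightarrow> Ck_on k S f"
proof (induction k arbitrary: f)
  case 0
  then show ?case
    by (auto intro!: continuous_at_imp_continuous_on differentiable_imp_continuous_within)
next
  case (Suc k)
  then show ?case by (metis Ck_on.simps(2))
qed

lemma Ck_on_2D:
  assumes "Ck_on 2 S f" "x \<in> S"
  shows "f differentiable (at x)" "(\<lambda>y. frechet_derivative f (at y) u) differentiable (at x)"
  using assms by (auto simp: numeral_2_eq_2)

lemma second_derivative_symmetric:
  fixes f :: "'a::euclidean_space \<Rightarrow> 'b::euclidean_space"
  assumes "open U" "x \<in> U" and C2: "Ck_on 2 U f"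
  shows "frechet_derivative (\<lambda>y. frechet_derivative f (at y) u) (at x) v =
    frechet_derivative (\<lambda>y. frechet_derivative f (at y) v) (at x) u"
proof (rule euclidean_eqI)
  fix b :: 'b
  define f' where "f' = (\<lambda>y. frechet_derivative f (at y))"
  define f'' where "f'' = (\<lambda>u y. frechet_derivative (\<lambda>y. f' y u) (at y))"
  have f: "(f has_derivative f' y) (at y)" if "y \<in> U" for y
    using Ck_on_2D(1)[OF C2 that] by (simp add: f'_def frechet_derivative_works)
  have f': "((\<lambda>y. f' y u) has_derivative f'' u y) (at y)" if "y \<in> U" for y u
    using Ck_on_2D(2)[OF C2 that] by (simp add: f'_def f''_def frechet_derivative_works)
  have cont: "continuous_on U (\<lambda>y. f'' u y v)" for u v
    using C2 by (simp add: numeral_2_eq_2 f'_def f''_def)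
  have "f'' u x v \<bullet> b = f'' v x u \<bullet> b"
    using second_derivative_symmetric_real[of U x "\<lambda>y. f y \<bullet> b" "\<lambda>y h. f' y h \<bullet> b" u
        "\<lambda>y h. f'' u y h \<bullet> b" v "\<lambda>y h. f'' v y h \<bullet> b"] assms(1,2)
      has_derivative_inner_left[OF f] has_derivative_inner_left[OF f'] cont
    by (simp add: continuous_on_inner)
  then show "frechet_derivative (\<lambda>y. frechet_derivative f (at y) u) (at x) v \<bullet> b =
    frechet_derivative (\<lambda>y. frechet_derivative f (at y) v) (at x) u \<bullet> b"
    by (simp add: f'_def f''_def)
qed

section \<open>Differentiation of bilinear maps that depend on a parameter\<close>

lemma bilinear_expand:
  fixes B :: "'a::euclidean_space \<Rightarrow> 'b::euclidean_space \<Rightarrow> 'c::real_vector"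
  assumes "bilinear B"
  shows "B u v = (\<Sum>i\<in>Basis. \<Sum>j\<in>Basis. ((u \<bullet> i) * (v \<bullet> j)) *\<^sub>R B i j)"
proof -
  have "B u v = B (\<Sum>i\<in>Basis. (u \<bullet> i) *\<^sub>R i) (\<Sum>j\<in>Basis. (v \<bullet> j) *\<^sub>R j)"
    by (simp add: euclidean_representation)
  also have "\<dots> = (\<Sum>i\<in>Basis. \<Sum>j\<in>Basis. B ((u \<bullet> i) *\<^sub>R i) ((v \<bullet> j) *\<^sub>R j))"
    by (simp add: bilinear_sum[OF assms] sum.cartesian_product)
  finally show ?thesis
    by (simp add: bilinear_lmul[OF assms] bilinear_rmul[OF assms] mult.commute)
qed

text \<open>A derivative depends only on the germ, so the identities that make \<open>B y\<close>
  bilinear on a neighbourhood of \<open>x\<close> pass to the derivatives by their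
  uniqueness.\<close>

lemma bilinear_frechet_derivative:
  fixes B :: "'x::real_normed_vector \<Rightarrow> 'a::real_vector \<Rightarrow> 'b::real_vector \<Rightarrow> 'c::real_normed_vector"
  assumes V: "open V" "x \<in> V" and B: "\<And>y. y \<in> V \<Longrightarrow> bilinear (B y)"
    and d: "\<And>u v. (\<lambda>y. B y u v) differentiable (at x)"
  shows "bilinear (\<lambda>u v. frechet_derivative (\<lambda>y. B y u v) (at x) w)"
proof -
  define D where "D = (\<lambda>u v. frechet_derivative (\<lambda>y. B y u v) (at x))"
  have D: "((\<lambda>y. B y u v) has_derivative D u v) (at x)" for u v
    using d by (simp add: D_def frechet_derivative_works)
  have uniq: "D u v = F" if "(F' has_derivative F) (at x)" "\<And>y. y \<in> V \<Longrightarrow> B y u v = F' y" for u v F F'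
    using has_derivative_unique[OF D] has_derivative_transform_within_open[OF that(1) V] that(2)
    by metis
  have "D (u + u') v = (\<lambda>h. D u v h + D u' v h)" for u u' v
    by (rule uniq[OF has_derivative_add[OF D D]]) (simp add: bilinear_ladd[OF B])
  moreover have "D u (v + v') = (\<lambda>h. D u v h + D u v' h)" for u v v'
    by (rule uniq[OF has_derivative_add[OF D D]]) (simp add: bilinear_radd[OF B])
  moreover have "D (c *\<^sub>R u) v = (\<lambda>h. c *\<^sub>R D u v h)" for c u v
    by (rule uniq[OF has_derivative_scaleR_right[OF D]]) (simp add: bilinear_lmul[OF B])
  moreover have "D u (c *\<^sub>R v) = (\<lambda>h. c *\<^sub>R D u v h)" for c u v
    by (rule uniq[OF has_derivative_scaleR_right[OF D]]) (simp add: bilinear_rmul[OF B])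
  ultimately have "bilinear (\<lambda>u v. D u v w)"
    unfolding bilinear_def by (auto intro!: linearI)
  then show ?thesis
    by (simp only: D_def)
qed

text \<open>A product rule in three factors. Differentiability of the family is given only for each
  fixed pair of arguments, so everything is expanded over the finite bases: then only products of
  differentiable functions occur, and bilinearity of \<open>B (f x)\<close> and of its derivative
  reassembles the sums.\<close>

lemma has_derivative_bilinear_family:
  fixes B :: "'y::real_normed_vector \<Rightarrow> 'a::euclidean_space \<Rightarrow> 'b::euclidean_space \<Rightarrow> 'c::real_normed_vector"
    and f :: "'x::real_normed_vector \<Rightarrow> 'y"
  assumes V: "open V" "f x \<in> V" and B: "\<And>y. y \<in> V \<Longrightarrow> bilinear (B y)"
    and d: "\<And>u v. (\<lambda>y. B y u v) differentiable (at (f x))"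
    and f: "(f has_derivative f') (at x)"
    and a: "(a has_derivative a') (at x)" and b: "(b has_derivative b') (at x)"
  shows "((\<lambda>x. B (f x) (a x) (b x)) has_derivative
    (\<lambda>h. frechet_derivative (\<lambda>y. B y (a x) (b x)) (at (f x)) (f' h) +
      B (f x) (a' h) (b x) + B (f x) (a x) (b' h))) (at x)"
proof -
  define D where "D = (\<lambda>u v. frechet_derivative (\<lambda>y. B y u v) (at (f x)))"
  have D: "((\<lambda>x. B (f x) u v) has_derivative (\<lambda>h. D u v (f' h))) (at x)" for u v
    using d unfolding D_def frechet_derivative_works
    by (rule has_derivative_compose[OF f])
  have bD: "bilinear (\<lambda>u v. D u v h)" for h
    unfolding D_def by (rule bilinear_frechet_derivative[OF V B d])
  note Bf = bilinear_expand[OF B[OF V(2)]]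
  have 1: "((\<lambda>x. \<Sum>i\<in>Basis. \<Sum>j\<in>Basis. ((a x \<bullet> i) * (b x \<bullet> j)) *\<^sub>R B (f x) i j) has_derivative
    (\<lambda>h. \<Sum>i\<in>Basis. \<Sum>j\<in>Basis. ((a x \<bullet> i) * (b x \<bullet> j)) *\<^sub>R D i j (f' h) +
      ((a x \<bullet> i) * (b' h \<bullet> j) + (a' h \<bullet> i) * (b x \<bullet> j)) *\<^sub>R B (f x) i j)) (at x)"
    by (intro has_derivative_sum has_derivative_scaleR has_derivative_mult
        has_derivative_inner_left a b D)
  have 2: "(\<Sum>i\<in>Basis. \<Sum>j\<in>Basis. ((a x \<bullet> i) * (b x \<bullet> j)) *\<^sub>R D i j (f' h) +
      ((a x \<bullet> i) * (b' h \<bullet> j) + (a' h \<bullet> i) * (b x \<bullet> j)) *\<^sub>R B (f x) i j) =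
    D (a x) (b x) (f' h) + B (f x) (a' h) (b x) + B (f x) (a x) (b' h)" for h
    unfolding bilinear_expand[OF bD, of "a x" "b x"] Bf[of "a' h" "b x"] Bf[of "a x" "b' h"]
    by (simp add: sum.distrib scaleR_add_left)
  have "\<forall>\<^sub>F x' in at x. f x' \<in> V"
    using has_derivative_continuous[OF f] V by (simp add: continuous_at topological_tendstoD)
  then have 3: "\<forall>\<^sub>F x' in at x. (\<Sum>i\<in>Basis. \<Sum>j\<in>Basis. ((a x' \<bullet> i) * (b x' \<bullet> j)) *\<^sub>R B (f x') i j) =
      B (f x') (a x') (b x')"
    by eventually_elim (rule bilinear_expand[OF B, symmetric])
  show ?thesis
    using has_derivative_transform_eventually[OF 1 3 Bf[symmetric] UNIV_I] unfolding 2 unfolding D_def .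
qed

text \<open>Where one factor vanishes, continuity of the other is enough: the error is the
  linearisation error of \<open>a\<close> times \<open>w y\<close>, plus
  \<open>a' (y - x) * (w y - w x)\<close>, and both are o(norm (y - x)). This lets the solution of a
  linear system gain a derivative that it is not yet known to have.\<close>

lemma has_derivative_mult_at_zero:
  fixes a w :: "'a::real_normed_vector \<Rightarrow> real"
  assumes a: "(a has_derivative a') (at x)" and a0: "a x = 0" and w: "isCont w x"
  shows "((\<lambda>y. a y * w y) has_derivative (\<lambda>h. a' h * w x)) (at x)"
proof -
  have lin: "bounded_linear a'" using a by (rule has_derivative_bounded_linear)
  obtain C where C: "\<And>h. norm (a' h) \<le> norm h * C" "C > 0"
    using bounded_linear.pos_bounded[OF lin] by blast
  have q: "((\<lambda>y. (a y - a x - a' (y - x)) /\<^sub>R norm (y - x)) \<longlongrightarrow> 0) (at x)"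
    using a by (simp add: has_derivative_at_within)
  have w': "(w \<longlongrightarrow> w x) (at x)" using w by (simp add: isCont_def)
  have "((\<lambda>y. (a y - a x - a' (y - x)) /\<^sub>R norm (y - x) * w y) \<longlongrightarrow> 0 * w x) (at x)"
    by (rule tendsto_mult[OF q w'])
  moreover have "((\<lambda>y. a' (y - x) /\<^sub>R norm (y - x) * (w y - w x)) \<longlongrightarrow> 0) (at x)"
  proof (rule Lim_null_comparison)
    show "\<forall>\<^sub>F y in at x. norm (a' (y - x) /\<^sub>R norm (y - x) * (w y - w x)) \<le> C * \<bar>w y - w x\<bar>"
    proof (rule always_eventually, rule allI)
      fix y
      have "\<bar>a' (y - x)\<bar> / norm (y - x) \<le> C"
        using C(1)[of "y - x"] C(2) by (cases "y = x") (auto simp: field_simps)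
      from mult_right_mono[OF this abs_ge_zero[of "w y - w x"]]
      show "norm (a' (y - x) /\<^sub>R norm (y - x) * (w y - w x)) \<le> C * \<bar>w y - w x\<bar>"
        by (simp add: abs_mult divide_inverse mult.commute)
    qed
    show "((\<lambda>y. C * \<bar>w y - w x\<bar>) \<longlongrightarrow> 0) (at x)"
      using w' by (intro tendsto_mult_right_zero tendsto_rabs_zero) (rule LIM_zero)
  qed
  ultimately have "((\<lambda>y. (a y - a x - a' (y - x)) /\<^sub>R norm (y - x) * w y +
      a' (y - x) /\<^sub>R norm (y - x) * (w y - w x)) \<longlongrightarrow> 0) (at x)"
    using tendsto_add by fastforce
  moreover have "(a y - a x - a' (y - x)) /\<^sub>R norm (y - x) * w y +
      a' (y - x) /\<^sub>R norm (y - x) * (w y - w x) =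
      (a y * w y - a x * w x - a' (y - x) * w x) /\<^sub>R norm (y - x)" for y
    by (simp add: a0 algebra_simps)
  ultimately have "((\<lambda>y. (a y * w y - a x * w x - a' (y - x) * w x) /\<^sub>R norm (y - x)) \<longlongrightarrow> 0) (at x)"
    by simp
  then show ?thesis
    using bounded_linear_mult_const[OF lin, of "w x"] by (simp add: has_derivative_at_within)
qed

section \<open>Linear systems: solvability and differentiable dependence on a parameter\<close>

lemma linear_expand:
  fixes f :: "'a::euclidean_space \<Rightarrow> 'b::real_vector"
  assumes "linear f"
  shows "f z = (\<Sum>i\<in>Basis. (z \<bullet> i) *\<^sub>R f i)"
proof -
  have "f z = f (\<Sum>i\<in>Basis. (z \<bullet> i) *\<^sub>R i)" by (simp add: euclidean_representation)
  also have "\<dots> = (\<Sum>i\<in>Basis. (z \<bullet> i) *\<^sub>R f i)"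
    unfolding linear_sum[OF assms] linear_cmul[OF assms] ..
  finally show ?thesis .
qed

text \<open>\<open>L\<close> sends \<open>w\<close> to the Euclidean gradient of the functional
  \<open>b w\<close>. Nondegeneracy makes it injective, and an injective linear endomorphism in
  finite dimension is surjective.\<close>

lemma nondegenerate_represents:
  fixes b :: "'e::euclidean_space \<Rightarrow> 'e \<Rightarrow> real"
  assumes b: "bilinear b" and sym: "\<And>u v. b u v = b v u"
    and nondeg: "\<And>u. (\<And>v. b u v = 0) \<Longrightarrow> u = 0" and k: "linear k"
  shows "\<exists>w. \<forall>z. b w z = k z"
proof -
  define L where "L = (\<lambda>w. \<Sum>i\<in>Basis. b w i *\<^sub>R i)"
  have L: "L w \<bullet> z = b w z" for w z
  proof -
    have "linear (b w)" using b by (simp add: bilinear_def)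
    from linear_expand[OF this, of z] show ?thesis
      by (simp add: L_def inner_sum_left inner_commute[of z] mult.commute)
  qed
  have "linear L"
    by (rule linearI) (simp_all add: L_def bilinear_ladd[OF b] bilinear_lmul[OF b]
        sum.distrib scaleR_add_left scaleR_sum_right)
  moreover have "inj L"
    unfolding linear_injective_0[OF \<open>linear L\<close>]
  proof (intro allI impI)
    fix u assume "L u = 0"
    then have "b u v = 0" for v using L[of u v] by simp
    then show "u = 0" by (rule nondeg)
  qed
  ultimately have "surj L" by (rule linear_injective_imp_surjective) (rule refl)
  then obtain w where w: "L w = (\<Sum>i\<in>Basis. k i *\<^sub>R i)"
    unfolding surj_def by metis
  have "b w z = k z" for z
    using linear_expand[OF k, of z] L[of w z]
    by (simp add: w inner_sum_left inner_commute[of z] mult.commute)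
  then show ?thesis by blast
qed

text \<open>With \<open>d\<close> dual to the standard basis, the system reads \<open>w = k(d) - a w\<close> where \<open>a\<close> vanishes at \<open>x\<close>. So \<open>w\<close> is
  bounded near \<open>x\<close>, then continuous at \<open>x\<close>, then differentiable at \<open>x\<close>.\<close>

lemma differentiable_linear_system_solution:
  fixes G :: "'x::real_normed_vector \<Rightarrow> 'e::euclidean_space \<Rightarrow> 'e \<Rightarrow> real"
  assumes V: "open V" "x \<in> V"
    and bil: "\<And>y. y \<in> V \<Longrightarrow> bilinear (G y)"
    and sym: "\<And>u v. G x u v = G x v u" and nondeg: "\<And>u. (\<And>v. G x u v = 0) \<Longrightarrow> u = 0"
    and dG: "\<And>u v. (\<lambda>y. G y u v) differentiable (at x)"
    and dk: "\<And>z. (\<lambda>y. k y z) differentiable (at x)"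
    and w: "\<And>y z. y \<in> V \<Longrightarrow> G y (w y) z = k y z"
  shows "w differentiable (at x)"
proof -
  have "\<exists>z. \<forall>v. G x z v = b \<bullet> v" for b
    using bil[OF V(2)] sym nondeg
    by (rule nondegenerate_represents) (simp_all add: bounded_linear.linear bounded_linear_inner_right)
  then have "\<forall>b. \<exists>z. \<forall>v. G x z v = b \<bullet> v" by blast
  from choice[OF this] obtain d where d: "\<And>b v. G x (d b) v = b \<bullet> v" by blast
  define a where "a = (\<lambda>b i y. G y i (d b) - G x i (d b))"
  have a0: "a b i x = 0" for b i by (simp add: a_def)
  have diff_a: "a b i differentiable (at x)" for b i
    unfolding a_def by (intro differentiable_diff dG differentiable_const)
  have wb: "w y \<bullet> b = k y (d b) - (\<Sum>i\<in>Basis. a b i y * (w y \<bullet> i))" if "y \<in> V" for y b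
  proof -
    have lin: "G y' (w y) z = (\<Sum>i\<in>Basis. (w y \<bullet> i) * G y' i z)" if "y' \<in> V" for y' z
    proof -
      have "linear (\<lambda>u. G y' u z)" using bil[OF that] by (simp add: bilinear_def)
      from linear_expand[OF this, of "w y"] show ?thesis by simp
    qed
    have "w y \<bullet> b = G x (w y) (d b)" by (subst sym) (simp add: d inner_commute)
    also have "\<dots> = G y (w y) (d b) - (\<Sum>i\<in>Basis. a b i y * (w y \<bullet> i))"
      unfolding lin[OF that] lin[OF V(2)]
      by (simp add: a_def sum_subtractf right_diff_distrib mult.commute[of _ "w y \<bullet> _"])
    finally show ?thesis using w[OF that] by simp
  qed
  have "((\<lambda>y. \<Sum>b\<in>Basis. \<bar>k y (d b)\<bar>) \<longlongrightarrow> (\<Sum>b\<in>Basis. \<bar>k x (d b)\<bar>)) (at x)"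
    using differentiable_imp_continuous_within[OF dk]
    by (intro tendsto_sum tendsto_rabs) (auto simp: continuous_within)
  then have ev1: "\<forall>\<^sub>F y in at x. (\<Sum>b\<in>Basis. \<bar>k y (d b)\<bar>) < (\<Sum>b\<in>Basis. \<bar>k x (d b)\<bar>) + 1"
    by (rule order_tendstoD(2)) simp
  have lim_a: "(a b i \<longlongrightarrow> 0) (at x)" for b i
    using differentiable_imp_continuous_within[OF diff_a, of b i] by (simp add: continuous_within a0)
  then have "((\<lambda>y. \<Sum>b\<in>Basis. \<Sum>i\<in>Basis. \<bar>a b i y\<bar>) \<longlongrightarrow> (\<Sum>b\<in>(Basis::'e set). \<Sum>i\<in>(Basis::'e set). \<bar>0\<bar>)) (at x)"
    by (intro tendsto_sum tendsto_rabs)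
  then have ev2: "\<forall>\<^sub>F y in at x. (\<Sum>b\<in>Basis. \<Sum>i\<in>Basis. \<bar>a b i y\<bar>) < 1 / 2"
    by (rule order_tendstoD(2)) simp
  \<comment> \<open>Near \<open>x\<close> the estimate reads norm (w y) \<le> M + 1 + norm (w y) /
    2, with M the value of the first sum at \<open>x\<close>. The bound 1/2 allows the last term to
    be absorbed on the left, which yields this constant.\<close>
  define C where "C = 2 * ((\<Sum>b\<in>Basis. \<bar>k x (d b)\<bar>) + 1)"
  have ev: "\<forall>\<^sub>F y in at x. norm (w y) \<le> C"
    using ev1 ev2 topological_tendstoD[OF tendsto_ident_at V]
  proof eventually_elim
    case (elim y)
    have "norm (w y) \<le> (\<Sum>b\<in>Basis. \<bar>w y \<bullet> b\<bar>)" by (rule norm_le_l1)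
    also have "\<dots> \<le> (\<Sum>b\<in>Basis. \<bar>k y (d b)\<bar> + (\<Sum>i\<in>Basis. \<bar>a b i y\<bar> * norm (w y)))"
    proof (rule sum_mono)
      fix b :: 'e assume "b \<in> Basis"
      have "\<bar>w y \<bullet> b\<bar> \<le> \<bar>k y (d b)\<bar> + \<bar>\<Sum>i\<in>Basis. a b i y * (w y \<bullet> i)\<bar>"
        using wb[OF elim(3), of b] by linarith
      also have "\<bar>\<Sum>i\<in>Basis. a b i y * (w y \<bullet> i)\<bar> \<le> (\<Sum>i\<in>Basis. \<bar>a b i y\<bar> * norm (w y))"
        by (rule order_trans[OF sum_abs])
          (auto intro!: sum_mono mult_left_mono simp: abs_mult Basis_le_norm)
      finally show "\<bar>w y \<bullet> b\<bar> \<le> \<bar>k y (d b)\<bar> + (\<Sum>i\<in>Basis. \<bar>a b i y\<bar> * norm (w y))" by simp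
    qed
    also have "\<dots> = (\<Sum>b\<in>Basis. \<bar>k y (d b)\<bar>) + (\<Sum>b\<in>Basis. \<Sum>i\<in>Basis. \<bar>a b i y\<bar>) * norm (w y)"
      by (simp add: sum.distrib sum_distrib_right)
    also have "\<dots> \<le> (\<Sum>b\<in>Basis. \<bar>k y (d b)\<bar>) + 1 / 2 * norm (w y)"
      using elim(2) by (intro add_left_mono mult_right_mono) auto
    finally show ?case using elim(1) by (simp add: C_def)
  qed
  have lim_aw: "((\<lambda>y. a b i y * (w y \<bullet> j)) \<longlongrightarrow> 0) (at x)" if "j \<in> Basis" for b i j
  proof (rule Lim_null_comparison)
    show "\<forall>\<^sub>F y in at x. norm (a b i y * (w y \<bullet> j)) \<le> \<bar>a b i y\<bar> * C"
      using ev by eventually_elim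
        (auto simp: abs_mult intro!: mult_left_mono order_trans[OF Basis_le_norm[OF that]])
    show "((\<lambda>y. \<bar>a b i y\<bar> * C) \<longlongrightarrow> 0) (at x)"
      using lim_a by (intro tendsto_mult_left_zero tendsto_rabs_zero)
  qed
  have cont: "isCont (\<lambda>y. w y \<bullet> b) x" for b
  proof -
    have "((\<lambda>y. k y (d b) - (\<Sum>i\<in>Basis. a b i y * (w y \<bullet> i))) \<longlongrightarrow> k x (d b) - (\<Sum>i\<in>(Basis::'e set). 0)) (at x)"
      using differentiable_imp_continuous_within[OF dk]
      by (intro tendsto_diff tendsto_sum lim_aw) (auto simp: continuous_within)
    moreover have "w x \<bullet> b = k x (d b)" using wb[OF V(2), of b] by (simp add: a0)
    moreover have "\<forall>\<^sub>F y in at x. k y (d b) - (\<Sum>i\<in>Basis. a b i y * (w y \<bullet> i)) = w y \<bullet> b"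
      using topological_tendstoD[OF tendsto_ident_at V] by eventually_elim (rule wb[symmetric])
    ultimately show ?thesis unfolding isCont_def by (simp add: tendsto_cong)
  qed
  have "(\<lambda>y. w y \<bullet> b) differentiable (at x)" for b
  proof -
    have "(\<lambda>y. a b i y * (w y \<bullet> i)) differentiable (at x)" for i
    proof -
      obtain D where "(a b i has_derivative D) (at x)"
        using diff_a unfolding differentiable_def by blast
      from has_derivative_mult_at_zero[OF this a0 cont[of i]]
      show ?thesis by (rule differentiableI)
    qed
    then have "(\<lambda>y. k y (d b) - (\<Sum>i\<in>Basis. a b i y * (w y \<bullet> i))) differentiable (at x)"
      by (intro differentiable_diff dk differentiable_sum finite_Basis) auto
    then obtain D where D: "((\<lambda>y. k y (d b) - (\<Sum>i\<in>Basis. a b i y * (w y \<bullet> i))) has_derivative D) (at x)"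
      unfolding differentiable_def by blast
    have "((\<lambda>y. w y \<bullet> b) has_derivative D) (at x)"
      by (rule has_derivative_transform_within_open[OF D V]) (rule wb[symmetric])
    then show ?thesis unfolding differentiable_def by blast
  qed
  then have "(\<lambda>y. \<Sum>b\<in>Basis. (w y \<bullet> b) *\<^sub>R b) differentiable (at x)"
    by (intro differentiable_sum finite_Basis differentiable_scaleR differentiable_const) auto
  then show ?thesis by (simp add: euclidean_representation)
qed

section \<open>Metrics on open subsets of Euclidean space\<close>

abbreviation fderiv :: "('a::real_normed_vector \<Rightarrow> 'b::real_normed_vector) \<Rightarrow> 'a \<Rightarrow> 'a \<Rightarrow> 'b" where
  "fderiv f x \<equiv> frechet_derivative f (at x)"

lemma fderiv_eqI: "(f has_derivative f') (at x) \<Longrightarrow> fderiv f x = f'"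
  by (rule frechet_derivative_at[symmetric])

lemma fderiv_works: "f differentiable (at x) \<Longrightarrow> (f has_derivative fderiv f x) (at x)"
  by (simp add: frechet_derivative_works)

text \<open>These are the Christoffel symbols of the first kind. Fields with constant components
  commute, so the bracket terms of the Koszul formula are absent.\<close>

definition koszul :: "('e::euclidean_space \<Rightarrow> 'e \<Rightarrow> 'e \<Rightarrow> real) \<Rightarrow> 'e \<Rightarrow> 'e \<Rightarrow> 'e \<Rightarrow> 'e \<Rightarrow> real" where
  "koszul G x u v z =
    (fderiv (\<lambda>y. G y v z) x u + fderiv (\<lambda>y. G y u z) x v - fderiv (\<lambda>y. G y u v) x z) / 2"

definition levi_civita :: "('e::euclidean_space \<Rightarrow> 'e \<Rightarrow> 'e \<Rightarrow> real) \<Rightarrow> 'e \<Rightarrow> 'e \<Rightarrow> 'e \<Rightarrow> 'e" where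
  "levi_civita G x u v = (THE w. \<forall>z. G x w z = koszul G x u v z)"

definition riemann :: "('e::euclidean_space \<Rightarrow> 'e \<Rightarrow> 'e \<Rightarrow> real) \<Rightarrow> 'e \<Rightarrow> 'e \<Rightarrow> 'e \<Rightarrow> 'e \<Rightarrow> 'e" where
  "riemann G x u v w =
    fderiv (\<lambda>y. levi_civita G y v w) x u - fderiv (\<lambda>y. levi_civita G y u w) x v +
    levi_civita G x u (levi_civita G x v w) - levi_civita G x v (levi_civita G x u w)"

definition gram :: "('e \<Rightarrow> 'e \<Rightarrow> real) \<Rightarrow> 'e \<Rightarrow> 'e \<Rightarrow> real" where
  "gram b u v = b u u * b v v - (b u v)\<^sup>2"

lemma christoffel_eq: "christoffel A g c = levi_civita (metric_in A g c)"
proof (intro ext)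
  fix x u v
  have "2 * a = b \<longleftrightarrow> a = b / 2" for a b :: real by auto
  then show "christoffel A g c x u v = levi_civita (metric_in A g c) x u v"
    by (simp add: christoffel_def levi_civita_def koszul_def)
qed

lemma curvature_tensor_eq:
  "curvature_tensor A g p = riemann (metric_in A g (chart_at A p)) (snd (chart_at A p) p)"
  by (intro ext) (simp add: curvature_tensor_def riemann_def christoffel_eq Let_def)

text \<open>Nondegeneracy instead of definiteness lets the same facts serve the Lorentzian ambient
  metric and the induced Riemannian one. Two derivatives are what curvature requires.\<close>

locale local_metric =
  fixes V :: "'e::euclidean_space set" and G :: "'e \<Rightarrow> 'e \<Rightarrow> 'e \<Rightarrow> real"
  assumes openV: "open V"
    and bil: "\<And>y. y \<in> V \<Longrightarrow> bilinear (G y)"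
    and sym: "\<And>y u v. G y u v = G y v u"
    and nondeg: "\<And>y u. y \<in> V \<Longrightarrow> (\<And>v. G y u v = 0) \<Longrightarrow> u = 0"
    and C2: "\<And>u v. Ck_on 2 V (\<lambda>y. G y u v)"
begin

abbreviation "\<Gamma> \<equiv> levi_civita G"
abbreviation "K \<equiv> koszul G"
abbreviation "R \<equiv> riemann G"

lemma eqI:
  assumes "y \<in> V" "\<And>z. G y u z = G y v z"
  shows "u = v"
proof -
  have "G y (u - v) z = 0" for z
    using assms by (simp add: bilinear_lsub[OF bil])
  then show ?thesis using nondeg[OF assms(1)] by (metis eq_iff_diff_eq_0)
qed

lemma dG: "y \<in> V \<Longrightarrow> (\<lambda>y. G y u v) differentiable (at y)"
  using Ck_on_2D(1)[OF C2] .

lemma ddG: "y \<in> V \<Longrightarrow> (\<lambda>y. fderiv (\<lambda>y. G y u v) y w) differentiable (at y)"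
  using Ck_on_2D(2)[OF C2] .

lemma dG_sym: "fderiv (\<lambda>y. G y u v) x = fderiv (\<lambda>y. G y v u) x"
  by (simp add: sym[of _ u v])

lemma dG_bilinear: "y \<in> V \<Longrightarrow> bilinear (\<lambda>u v. fderiv (\<lambda>y. G y u v) y w)"
  by (rule bilinear_frechet_derivative[OF openV _ bil dG])

lemma dG_linear: "y \<in> V \<Longrightarrow> linear (fderiv (\<lambda>y. G y u v) y)"
  by (rule linear_frechet_derivative[OF dG])

lemma koszul_linear:
  assumes y: "y \<in> V"
  shows "linear (K y u v)" "linear (\<lambda>u. K y u v z)" "linear (\<lambda>v. K y u v z)"
proof -
  note l = bilinear_ladd[OF dG_bilinear[OF y]] bilinear_radd[OF dG_bilinear[OF y]]
    bilinear_lmul[OF dG_bilinear[OF y]] bilinear_rmul[OF dG_bilinear[OF y]]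
    linear_add[OF dG_linear[OF y]] linear_cmul[OF dG_linear[OF y]]
  show "linear (K y u v)" "linear (\<lambda>u. K y u v z)" "linear (\<lambda>v. K y u v z)"
    by (rule linearI; simp add: koszul_def l field_simps)+
qed

lemma koszul_sym: "K y u v z = K y v u z"
  by (simp add: koszul_def dG_sym[of u v])

text \<open>The Koszul expression is linear in \<open>z\<close>, so nondegeneracy represents it by
  exactly one vector, and the \<open>THE\<close> in the definition denotes that vector.\<close>

lemma levi_civita: "y \<in> V \<Longrightarrow> G y (\<Gamma> y u v) z = K y u v z"
proof -
  assume y: "y \<in> V"
  obtain w where w: "\<And>z. G y w z = K y u v z"
    using nondegenerate_represents[OF bil[OF y] sym nondeg[OF y] koszul_linear(1)[OF y]] by blast
  have "\<Gamma> y u v = w"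
    unfolding levi_civita_def by (rule the_equality) (auto intro: eqI[OF y] simp: w)
  then show ?thesis by (simp add: w)
qed

lemma levi_civita_sym: "y \<in> V \<Longrightarrow> \<Gamma> y u v = \<Gamma> y v u"
  by (rule eqI) (auto simp: levi_civita koszul_sym[of _ u])

lemma levi_civita_bilinear:
  assumes y: "y \<in> V"
  shows "bilinear (\<Gamma> y)"
proof -
  have 1: "\<Gamma> y u (v + v') = \<Gamma> y u v + \<Gamma> y u v'" for u v v'
    by (rule eqI[OF y])
      (simp add: levi_civita[OF y] bilinear_ladd[OF bil[OF y]] linear_add[OF koszul_linear(3)[OF y]])
  have 2: "\<Gamma> y u (c *\<^sub>R v) = c *\<^sub>R \<Gamma> y u v" for u v c
    by (rule eqI[OF y])
      (simp add: levi_civita[OF y] bilinear_lmul[OF bil[OF y]] linear_cmul[OF koszul_linear(3)[OF y]])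
  show ?thesis
    unfolding bilinear_def
    by (auto intro!: linearI simp: 1 2 levi_civita_sym[OF y, of _ "_::'e"])
qed

lemma koszul_differentiable: "y \<in> V \<Longrightarrow> (\<lambda>y. K y u v z) differentiable (at y)"
  unfolding koszul_def divide_inverse
  by (intro differentiable_mult differentiable_add differentiable_diff ddG differentiable_const)

text \<open>By \<open>levi_civita\<close>, \<open>\<Gamma> y u v\<close> solves a linear system
  whose coefficients and right-hand side are differentiable in \<open>y\<close>; no inverse matrix
  of the metric has to be formed.\<close>

lemma levi_civita_differentiable: "y \<in> V \<Longrightarrow> (\<lambda>y. \<Gamma> y u v) differentiable (at y)"
  by (rule differentiable_linear_system_solution[OF openV _ bil sym nondeg dG koszul_differentiable levi_civita])

text \<open>In \<open>K y u v z + K y u z v\<close> the derivatives in directions \<open>v\<close>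
  and \<open>z\<close> cancel, and the derivative in direction \<open>u\<close> occurs with total
  weight one.\<close>

lemma metric_compatible:
  assumes "y \<in> V"
  shows "fderiv (\<lambda>y. G y v z) y u = G y (\<Gamma> y u v) z + G y v (\<Gamma> y u z)"
  unfolding sym[of y v] levi_civita[OF assms]
  by (simp add: koszul_def dG_sym[of z v] field_simps)

text \<open>Differentiating \<open>G y (\<Gamma> y v w) z = K y v w z\<close> trades derivatives of
  \<open>\<Gamma>\<close> for derivatives of \<open>K\<close>, and \<open>metric_compatible\<close>
  accounts for the derivative of \<open>G\<close>. In this form the curvature of an induced metric
  is accessible, because its \<open>K\<close> has an explicit formula in terms of the
  immersion.\<close>

lemma riemann_lower:
  assumes x: "x \<in> V"
  shows "G x (R x u v w) z = fderiv (\<lambda>y. K y v w z) x u - fderiv (\<lambda>y. K y u w z) x v -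
    G x (\<Gamma> x v w) (\<Gamma> x u z) + G x (\<Gamma> x u w) (\<Gamma> x v z)"
proof -
  have D: "fderiv (\<lambda>y. K y v w z) x u =
    G x (\<Gamma> x u (\<Gamma> x v w)) z + G x (\<Gamma> x v w) (\<Gamma> x u z) + G x (fderiv (\<lambda>y. \<Gamma> y v w) x u) z" for u v
  proof -
    have "((\<lambda>y. G y (\<Gamma> y v w) z) has_derivative
        (\<lambda>h. fderiv (\<lambda>y. G y (\<Gamma> x v w) z) x h + G x (fderiv (\<lambda>y. \<Gamma> y v w) x h) z +
          G x (\<Gamma> x v w) 0)) (at x)"
      by (rule has_derivative_bilinear_family[where f="\<lambda>x. x", OF openV x bil dG[OF x]])
        (auto intro!: fderiv_works levi_civita_differentiable x)
    then have "((\<lambda>y. K y v w z) has_derivative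
        (\<lambda>h. fderiv (\<lambda>y. G y (\<Gamma> x v w) z) x h + G x (fderiv (\<lambda>y. \<Gamma> y v w) x h) z +
          G x (\<Gamma> x v w) 0)) (at x)"
      by (rule has_derivative_transform_within_open[OF _ openV x]) (rule levi_civita)
    from fderiv_eqI[OF this] show ?thesis
      by (simp add: metric_compatible[OF x] bilinear_rzero[OF bil[OF x]])
  qed
  show ?thesis
    unfolding D riemann_def
    by (simp add: bilinear_ladd[OF bil[OF x]] bilinear_lsub[OF bil[OF x]])
qed

text \<open>With \<open>H\<close> the second derivatives of the metric, the term
  \<open>H u v w z\<close> drops out of the alternation in \<open>u\<close> and \<open>v\<close>
  because partial derivatives commute; what is left changes sign when \<open>w\<close> and
  \<open>z\<close> are exchanged.\<close>

lemma riemann_skew: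
  assumes x: "x \<in> V"
  shows "G x (R x u v w) z = - G x (R x u v z) w"
proof -
  define H where "H = (\<lambda>u v w z. fderiv (\<lambda>y. fderiv (\<lambda>y. G y w z) y v) x u)"
  have H: "((\<lambda>y. fderiv (\<lambda>y. G y w z) y v) has_derivative (\<lambda>u. H u v w z)) (at x)" for v w z
    unfolding H_def by (rule fderiv_works[OF ddG[OF x]])
  have H1: "H u v w z = H v u w z" for u v w z
    unfolding H_def by (rule second_derivative_symmetric[OF openV x C2])
  have "((\<lambda>y. K y v w z) has_derivative (\<lambda>u. (H u v w z + H u w v z - H u z v w) / 2)) (at x)" for v w z
    unfolding koszul_def by (intro derivative_eq_intros H) (auto intro: H)
  from fderiv_eqI[OF this]
  have D: "fderiv (\<lambda>y. K y v w z) x u = (H u v w z + H u w v z - H u z v w) / 2" for u v w z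
    by simp
  show ?thesis
    unfolding riemann_lower[OF x] D
    using H1[of u v w z] H1[of u v z w]
      sym[of x "\<Gamma> x v w" "\<Gamma> x u z"] sym[of x "\<Gamma> x v z" "\<Gamma> x u w"]
    by (simp add: field_simps)
qed

lemma riemann_bilinear:
  assumes x: "x \<in> V"
  shows "bilinear (\<lambda>u v. R x u v w)"
proof -
  note D = bilinear_frechet_derivative[OF openV x levi_civita_bilinear levi_civita_differentiable[OF x]]
  note D' = linear_frechet_derivative[OF levi_civita_differentiable[OF x]]
  note b = levi_civita_bilinear[OF x]
  note l = bilinear_ladd[OF D] bilinear_radd[OF D] bilinear_lmul[OF D] bilinear_rmul[OF D]
    bilinear_ladd[OF b] bilinear_radd[OF b] bilinear_lmul[OF b] bilinear_rmul[OF b]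
    linear_add[OF D'] linear_cmul[OF D']
  show ?thesis
    unfolding bilinear_def
    by (auto intro!: linearI simp: riemann_def l algebra_simps)
qed

lemma riemann_linear:
  assumes x: "x \<in> V"
  shows "linear (R x u v)"
proof -
  note D = bilinear_frechet_derivative[OF openV x levi_civita_bilinear levi_civita_differentiable[OF x]]
  note b = levi_civita_bilinear[OF x]
  note l = bilinear_radd[OF D] bilinear_rmul[OF D] bilinear_radd[OF b] bilinear_rmul[OF b]
  show ?thesis
    by (auto intro!: linearI simp: riemann_def l algebra_simps)
qed

text \<open>The determinant of the change of basis comes out once from the first two slots of
  \<open>R\<close>, and once more from the last slot together with the metric argument, by
  \<open>riemann_skew\<close>. The Gram determinant scales by the same square.\<close>

lemma sectional_change_basis:
  assumes x: "x \<in> V" and u: "u = p *\<^sub>R u' + q *\<^sub>R v'" and v: "v = r *\<^sub>R u' + s *\<^sub>R v'"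
  shows "G x (R x u v v) u = (p * s - q * r)\<^sup>2 * G x (R x u' v' v') u'"
    and "gram (G x) u v = (p * s - q * r)\<^sup>2 * gram (G x) u' v'"
proof -
  note b = riemann_bilinear[OF x] and c = bil[OF x] and d = riemann_linear[OF x]
  have alt: "R x w w z = 0" for w z by (simp add: riemann_def)
  have alt': "R x v' u' z = - R x u' v' z" for z by (simp add: riemann_def)
  have "R x u v z = (p * s - q * r) *\<^sub>R R x u' v' z" for z
    unfolding u v
    by (simp add: bilinear_ladd[OF b] bilinear_radd[OF b] bilinear_lmul[OF b] bilinear_rmul[OF b]
        alt alt' algebra_simps)
  moreover have "G x (R x u' v' v) u = (p * s - q * r) * G x (R x u' v' v') u'"
    using riemann_skew[OF x, of u' v' u' u'] riemann_skew[OF x, of u' v' v' v']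
      riemann_skew[OF x, of u' v' u' v']
    unfolding u v
    by (simp add: linear_add[OF d] linear_cmul[OF d] bilinear_ladd[OF c] bilinear_radd[OF c]
        bilinear_lmul[OF c] bilinear_rmul[OF c] algebra_simps)
  ultimately show "G x (R x u v v) u = (p * s - q * r)\<^sup>2 * G x (R x u' v' v') u'"
    by (simp add: bilinear_lmul[OF c] power2_eq_square)
  show "gram (G x) u v = (p * s - q * r)\<^sup>2 * gram (G x) u' v'"
    unfolding u v gram_def
    by (simp add: bilinear_ladd[OF c] bilinear_radd[OF c] bilinear_lmul[OF c] bilinear_rmul[OF c]
        sym[of x v' u'] power2_eq_square algebra_simps)
qed

text \<open>The pair \<open>u\<close>, \<open>v\<close> is written in terms of the arbitrary pair,
  not conversely: a nonzero Gram determinant of \<open>u\<close>, \<open>v\<close> then forces both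
  the determinant of the change of basis and \<open>gram (G x) u' v'\<close> to be nonzero.\<close>

lemma sectional_well_defined:
  assumes x: "x \<in> V" and gram: "gram (G x) u v \<noteq> 0" and sp: "span {u', v'} = span {u, v}"
  shows "G x (R x u' v' v') u' / gram (G x) u' v' = G x (R x u v v) u / gram (G x) u v"
proof -
  have "w \<in> span {u', v'} \<Longrightarrow> \<exists>p q. w = p *\<^sub>R u' + q *\<^sub>R v'" for w
    by (auto simp: span_insert span_singleton diff_eq_eq add.commute)
  moreover have "u \<in> span {u', v'}" "v \<in> span {u', v'}"
    unfolding sp by (auto intro: span_base)
  ultimately obtain p q r s where "u = p *\<^sub>R u' + q *\<^sub>R v'" "v = r *\<^sub>R u' + s *\<^sub>R v'"
    by meson
  from sectional_change_basis[OF x this] gram show ?thesis by auto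
qed

end

section \<open>The Gauss equation in coordinates\<close>

text \<open>Injectivity of the differential is implicit: a vector killed by
  \<open>fderiv f x\<close> would be \<open>h\<close>-orthogonal to everything, against
  nondegeneracy of \<open>h\<close>. Three derivatives of \<open>f\<close> are required because
  \<open>koszul h\<close> already contains two and is differentiated once more.\<close>

locale local_immersion = dom: local_metric U h + amb: local_metric V G
  for U :: "'d::euclidean_space set" and h and V :: "'e::euclidean_space set" and G +
  fixes f :: "'d \<Rightarrow> 'e"
  assumes fV: "\<And>x. x \<in> U \<Longrightarrow> f x \<in> V"
    and C3: "Ck_on 3 U f"
    and h: "\<And>x u v. x \<in> U \<Longrightarrow> h x u v = G (f x) (fderiv f x u) (fderiv f x v)"
begin

text \<open>This is the ambient covariant derivative, in direction \<open>u\<close>, of the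
  coordinate field with components \<open>v\<close> pushed forward along \<open>f\<close>, before
  any splitting into tangential and normal parts.\<close>

definition hess :: "'d \<Rightarrow> 'd \<Rightarrow> 'd \<Rightarrow> 'e" where
  "hess x u v = fderiv (\<lambda>y. fderiv f y v) x u + levi_civita G (f x) (fderiv f x u) (fderiv f x v)"

definition second_form :: "'d \<Rightarrow> 'd \<Rightarrow> 'd \<Rightarrow> 'e" where
  "second_form x u v = hess x u v - fderiv f x (levi_civita h x u v)"

lemma C2f: "Ck_on 2 U f" and C2df: "Ck_on 2 U (\<lambda>y. fderiv f y v)"
  using C3 Ck_on_Suc_imp[of 2 U f] by (simp_all add: numeral_3_eq_3 numeral_2_eq_2)

lemma f_derivative: "x \<in> U \<Longrightarrow> (f has_derivative fderiv f x) (at x)"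
  using Ck_on_2D(1)[OF C2f] by (rule fderiv_works)

lemma df_derivative:
  "x \<in> U \<Longrightarrow> ((\<lambda>y. fderiv f y v) has_derivative fderiv (\<lambda>y. fderiv f y v) x) (at x)"
  using Ck_on_2D(2)[OF C2f] by (rule fderiv_works)

lemma df_linear: "x \<in> U \<Longrightarrow> linear (fderiv f x)"
  using Ck_on_2D(1)[OF C2f] by (rule linear_frechet_derivative)

lemma hess_sym:
  assumes x: "x \<in> U"
  shows "hess x u v = hess x v u"
  using second_derivative_symmetric[OF dom.openV x C2f, of u v]
  by (simp add: hess_def amb.levi_civita_sym[OF fV[OF x], of "fderiv f x u"])

text \<open>Six terms of the Koszul expression of \<open>h\<close> contain second derivatives of
  \<open>f\<close>. By their symmetry four of them cancel and the other two coincide; the terms that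
  differentiate \<open>G\<close> form the ambient Koszul expression.\<close>

lemma koszul_pullback:
  assumes x: "x \<in> U"
  shows "koszul h x u v z = G (f x) (hess x u v) (fderiv f x z)"
proof -
  define D where "D = (\<lambda>u v. fderiv (\<lambda>y. fderiv f y v) x u)"
  have Dsym: "D u v = D v u" for u v
    unfolding D_def by (rule second_derivative_symmetric[OF dom.openV x C2f])
  have dh: "fderiv (\<lambda>y. h y v z) x u =
      fderiv (\<lambda>y. G y (fderiv f x v) (fderiv f x z)) (f x) (fderiv f x u) +
      G (f x) (D u v) (fderiv f x z) + G (f x) (fderiv f x v) (D u z)" for u v z
  proof -
    have "((\<lambda>x. G (f x) (fderiv f x v) (fderiv f x z)) has_derivative
       (\<lambda>u. fderiv (\<lambda>y. G y (fderiv f x v) (fderiv f x z)) (f x) (fderiv f x u) +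
        G (f x) (D u v) (fderiv f x z) + G (f x) (fderiv f x v) (D u z))) (at x)"
      unfolding D_def
      by (rule has_derivative_bilinear_family[OF amb.openV fV[OF x] amb.bil amb.dG[OF fV[OF x]]
            f_derivative[OF x] df_derivative[OF x] df_derivative[OF x]])
    then have "((\<lambda>y. h y v z) has_derivative
       (\<lambda>u. fderiv (\<lambda>y. G y (fderiv f x v) (fderiv f x z)) (f x) (fderiv f x u) +
        G (f x) (D u v) (fderiv f x z) + G (f x) (fderiv f x v) (D u z))) (at x)"
      by (rule has_derivative_transform_within_open[OF _ dom.openV x]) (rule h[symmetric])
    from fderiv_eqI[OF this] show ?thesis by simp
  qed
  have "hess x u v = D u v + levi_civita G (f x) (fderiv f x u) (fderiv f x v)"
    by (simp add: hess_def D_def)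
  then have "G (f x) (hess x u v) (fderiv f x z) =
      G (f x) (D u v) (fderiv f x z) + koszul G (f x) (fderiv f x u) (fderiv f x v) (fderiv f x z)"
    by (simp add: bilinear_ladd[OF amb.bil[OF fV[OF x]]] amb.levi_civita[OF fV[OF x]])
  moreover have "koszul h x u v z =
      G (f x) (D u v) (fderiv f x z) + koszul G (f x) (fderiv f x u) (fderiv f x v) (fderiv f x z)"
    unfolding koszul_def[of h] dh
    unfolding Dsym[of v u] Dsym[of z u] Dsym[of z v]
      amb.sym[of "f x" "fderiv f x v" "D u z"] amb.sym[of "f x" "fderiv f x u" "D v z"]
    by (simp add: koszul_def field_simps)
  ultimately show ?thesis by simp
qed

text \<open>By \<open>koszul_pullback\<close>, \<open>hess\<close> and the pushed-forward connection
  of \<open>h\<close> pair equally with every tangent vector, so the connection of \<open>h\<close>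
  is the tangential part of \<open>hess\<close>.\<close>

lemma second_form_normal:
  assumes x: "x \<in> U"
  shows "G (f x) (second_form x u v) (fderiv f x z) = 0"
proof -
  have "G (f x) (fderiv f x (levi_civita h x u v)) (fderiv f x z) = koszul h x u v z"
    using dom.levi_civita[OF x] h[OF x] by simp
  then show ?thesis
    by (simp add: second_form_def bilinear_lsub[OF amb.bil[OF fV[OF x]]] koszul_pullback[OF x])
qed

lemma second_form_sym: "x \<in> U \<Longrightarrow> second_form x u v = second_form x v u"
  by (simp add: second_form_def hess_sym[of x u] dom.levi_civita_sym[of x u])

lemma second_form_bilinear:
  assumes x: "x \<in> U"
  shows "bilinear (second_form x)"
proof -
  have D: "bilinear (\<lambda>u v. fderiv (\<lambda>y. fderiv f y v) x u)"
    unfolding bilinear_def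
  proof (intro conjI allI)
    \<comment> \<open>A Frechet derivative is linear in its own direction, here the outer slot;
      symmetry of second derivatives moves \<open>v\<close> there.\<close>
    show "linear (\<lambda>v. fderiv (\<lambda>y. fderiv f y v) x u)" for u
      using linear_frechet_derivative[OF Ck_on_2D(2)[OF C2f x]]
      unfolding second_derivative_symmetric[OF dom.openV x C2f, of _ u] .
    show "linear (\<lambda>u. fderiv (\<lambda>y. fderiv f y v) x u)" for v
      using linear_frechet_derivative[OF Ck_on_2D(2)[OF C2f x]] .
  qed
  note b = amb.levi_civita_bilinear[OF fV[OF x]] dom.levi_civita_bilinear[OF x]
  note l = linear_add[OF df_linear[OF x]] linear_cmul[OF df_linear[OF x]]
    b[THEN bilinear_ladd] b[THEN bilinear_radd] b[THEN bilinear_lmul] b[THEN bilinear_rmul]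
    bilinear_ladd[OF D] bilinear_radd[OF D] bilinear_lmul[OF D] bilinear_rmul[OF D]
  show ?thesis
    unfolding bilinear_def
    by (auto intro!: linearI simp: second_form_def hess_def l algebra_simps)
qed

lemma gauss_equation:
  assumes x: "x \<in> U"
  shows "h x (riemann h x u v w) z =
    G (f x) (riemann G (f x) (fderiv f x u) (fderiv f x v) (fderiv f x w)) (fderiv f x z) +
    G (f x) (second_form x v w) (second_form x u z) - G (f x) (second_form x u w) (second_form x v z)"
proof -
  let ?F = "fderiv f x" and ?b = "G (f x)" and ?\<Gamma> = "levi_civita G (f x)"
  note b = amb.bil[OF fV[OF x]] and \<Gamma>b = amb.levi_civita_bilinear[OF fV[OF x]]
  define D where "D = (\<lambda>u v. fderiv (\<lambda>y. fderiv f y v) x u)"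
  define T where "T = (\<lambda>u v w. fderiv (\<lambda>y. fderiv (\<lambda>y. fderiv f y w) y v) x u)"
  \<comment> \<open>By the product rule \<open>dS u v w\<close> is the derivative of
    \<open>hess y v w\<close> at \<open>x\<close> in direction \<open>u\<close>, with
    \<open>T\<close> for the third derivatives of \<open>f\<close>.\<close>
  define dS where "dS = (\<lambda>u v w. T u v w + (fderiv (\<lambda>y. levi_civita G y (?F v) (?F w)) (f x) (?F u) +
    ?\<Gamma> (D u v) (?F w) + ?\<Gamma> (?F v) (D u w)))"
  have Dsym: "D u v = D v u" for u v
    unfolding D_def by (rule second_derivative_symmetric[OF dom.openV x C2f])
  have Tsym: "T u v w = T v u w" for u v w
    unfolding T_def by (rule second_derivative_symmetric[OF dom.openV x C2df])
  have hess: "hess x u v = D u v + ?\<Gamma> (?F u) (?F v)" for u v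
    by (simp add: hess_def D_def)
  have dhess: "((\<lambda>y. hess y v w) has_derivative (\<lambda>u. dS u v w)) (at x)" for v w
    unfolding hess_def dS_def T_def D_def
    by (intro has_derivative_add
        has_derivative_bilinear_family[OF amb.openV fV[OF x] amb.levi_civita_bilinear
          amb.levi_civita_differentiable[OF fV[OF x]] f_derivative[OF x] df_derivative[OF x] df_derivative[OF x]]
        fderiv_works Ck_on_2D(2)[OF C2df x])
  have dK: "fderiv (\<lambda>y. koszul h y v w z) x u =
      ?b (dS u v w + ?\<Gamma> (?F u) (hess x v w)) (?F z) + ?b (hess x v w) (hess x u z)" for u v w z
  proof -
    have "((\<lambda>y. G (f y) (hess y v w) (fderiv f y z)) has_derivative
      (\<lambda>u. fderiv (\<lambda>y. G y (hess x v w) (?F z)) (f x) (?F u) + ?b (dS u v w) (?F z) +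
        ?b (hess x v w) (D u z))) (at x)"
      unfolding D_def
      by (rule has_derivative_bilinear_family[OF amb.openV fV[OF x] amb.bil amb.dG[OF fV[OF x]]
            f_derivative[OF x] dhess df_derivative[OF x]])
    then have "((\<lambda>y. koszul h y v w z) has_derivative
      (\<lambda>u. fderiv (\<lambda>y. G y (hess x v w) (?F z)) (f x) (?F u) + ?b (dS u v w) (?F z) +
        ?b (hess x v w) (D u z))) (at x)"
      by (rule has_derivative_transform_within_open[OF _ dom.openV x]) (rule koszul_pullback[symmetric])
    from fderiv_eqI[OF this] show ?thesis
      by (simp add: amb.metric_compatible[OF fV[OF x]] hess[of u z] bilinear_ladd[OF b] bilinear_radd[OF b])
  qed
  \<comment> \<open>The alternation removes \<open>T\<close> and the term with \<open>D u v\<close>,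
    both symmetric in \<open>u\<close> and \<open>v\<close>. The terms with \<open>D u w\<close> and
    \<open>D v w\<close> cancel against those inside \<open>hess\<close>, leaving the ambient
    curvature.\<close>
  have R: "dS u v w + ?\<Gamma> (?F u) (hess x v w) - (dS v u w + ?\<Gamma> (?F v) (hess x u w)) =
      riemann G (f x) (?F u) (?F v) (?F w)"
    by (simp add: dS_def riemann_def hess bilinear_radd[OF \<Gamma>b] Tsym[of u v] Dsym[of u v])
  \<comment> \<open>Normal and tangential parts are orthogonal. The tangential contribution is
    exactly the product of connection terms that \<open>riemann_lower\<close> subtracts for
    \<open>h\<close>, so only the second form survives.\<close>
  have split: "?b (hess x v w) (hess x u z) =
      ?b (second_form x v w) (second_form x u z) + h x (levi_civita h x v w) (levi_civita h x u z)" for u v w z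
  proof -
    have hs: "hess x u v = second_form x u v + ?F (levi_civita h x u v)" for u v
      by (simp add: second_form_def)
    have "?b (?F a) (second_form x u z) = 0" for a
      using second_form_normal[OF x] amb.sym by metis
    then show ?thesis
      by (simp add: hs bilinear_ladd[OF b] bilinear_radd[OF b] h[OF x] second_form_normal[OF x])
  qed
  show ?thesis
    unfolding dom.riemann_lower[OF x] dK split R[symmetric] bilinear_lsub[OF b]
    by simp
qed

end

section \<open>Charts\<close>

abbreviation local_rep :: "('a \<Rightarrow> 'b) \<Rightarrow> ('a, 'd) chart \<Rightarrow> ('b, 'e) chart \<Rightarrow> 'd \<Rightarrow> 'e" where
  "local_rep \<psi> c d \<equiv> snd d \<circ> \<psi> \<circ> chart_inv c"

lemma Ck_on_subset: "Ck_on k S f \<Longrightarrow> T \<subseteq> S \<Longrightarrow> Ck_on k T f"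
  by (induction k arbitrary: f) (auto intro: continuous_on_subset)

lemma local_metric_subset:
  assumes "local_metric V G" "open W" "W \<subseteq> V"
  shows "local_metric W G"
proof -
  interpret local_metric V G by fact
  show ?thesis
    using assms by unfold_locales (auto intro: bil sym nondeg Ck_on_subset[OF C2])
qed

lemma chart_at:
  assumes "smooth_atlas A"
  shows "chart_at A p \<in> A" "p \<in> fst (chart_at A p)"
proof -
  have "\<exists>c. c \<in> A \<and> p \<in> fst c" using assms unfolding smooth_atlas_def by blast
  from someI_ex[OF this] show "chart_at A p \<in> A" "p \<in> fst (chart_at A p)"
    by (simp_all add: chart_at_def)
qed

lemma chart_inv:
  assumes "smooth_atlas A" "c \<in> A"
  shows "p \<in> fst c \<Longrightarrow> chart_inv c (snd c p) = p"
    and "x \<in> snd c ` fst c \<Longrightarrow> chart_inv c x \<in> fst c"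
    and "x \<in> snd c ` fst c \<Longrightarrow> snd c (chart_inv c x) = x"
  using assms unfolding smooth_atlas_def homeomorphism_def by blast+

lemma chart_open:
  assumes "smooth_atlas A" "c \<in> A"
  shows "open (fst c)" "open (snd c ` fst c)"
  using assms unfolding smooth_atlas_def by blast+

lemma chart_image_open:
  assumes "smooth_atlas A" "c \<in> A" "open W"
  shows "open (snd c ` (fst c \<inter> W))"
proof -
  have "homeomorphism (fst c) (snd c ` fst c) (snd c) (chart_inv c)"
    using assms unfolding smooth_atlas_def by blast
  moreover have "openin (top_of_set (fst c)) (fst c \<inter> W)"
    using assms(3) by (rule openin_open_Int)
  ultimately have "openin (top_of_set (snd c ` fst c)) (snd c ` (fst c \<inter> W))"
    by (rule homeomorphism_imp_open_map)
  then show ?thesis using chart_open(2)[OF assms(1,2)] openin_open_trans by blast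
qed

lemma smooth_map_domain_open:
  assumes "smooth_atlas A" "c \<in> A" "smooth_map A B \<psi>" "open W"
  shows "open (snd c ` (fst c \<inter> \<psi> -` W))"
  using assms by (intro chart_image_open) (auto simp: smooth_map_def continuous_on_open_vimage)

lemma smooth_map_id:
  assumes "smooth_atlas A"
  shows "smooth_map A A id"
  using assms by (simp add: smooth_map_def smooth_atlas_def continuous_on_id')

lemma local_rep_derivative:
  assumes "smooth_map A B \<psi>" "c \<in> A" "d \<in> B" "q \<in> fst c" "\<psi> q \<in> fst d"
  shows "(local_rep \<psi> c d has_derivative fderiv (local_rep \<psi> c d) (snd c q)) (at (snd c q))"
proof -
  have "Ck_on (Suc 0) (snd c ` (fst c \<inter> \<psi> -` fst d)) (local_rep \<psi> c d)"
    using assms(1-3) unfolding smooth_map_def smooth_on_def by blast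
  moreover have "snd c q \<in> snd c ` (fst c \<inter> \<psi> -` fst d)" using assms by blast
  ultimately show ?thesis by (auto intro: fderiv_works)
qed

lemma coord_change_derivative:
  assumes "smooth_atlas A" "c \<in> A" "d \<in> A" "q \<in> fst c" "q \<in> fst d"
  shows "(snd d \<circ> chart_inv c has_derivative coord_change c d q) (at (snd c q))"
  using local_rep_derivative[OF smooth_map_id[OF assms(1)], of c d q] assms
  by (simp add: coord_change_def[abs_def])

lemma coord_change_linear:
  assumes "smooth_atlas A" "c \<in> A" "d \<in> A" "q \<in> fst c" "q \<in> fst d"
  shows "linear (coord_change c d q)"
  using coord_change_derivative[OF assms] by (rule has_derivative_linear)

text \<open>The chain rule, applied after noting that the two local representatives differ by the
  transition map on an open neighbourhood; a germ is all that the derivative sees.\<close>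

lemma local_rep_change_source:
  assumes A: "smooth_atlas A" and \<psi>: "smooth_map A B \<psi>"
    and c: "c \<in> A" "c' \<in> A" "e \<in> B" and q: "q \<in> fst c" "q \<in> fst c'" "\<psi> q \<in> fst e"
  shows "fderiv (local_rep \<psi> c' e) (snd c' q) (coord_change c c' q u) = fderiv (local_rep \<psi> c e) (snd c q) u"
proof -
  have eq: "(snd c' \<circ> chart_inv c) (snd c q) = snd c' q"
    using chart_inv(1)[OF A c(1) q(1)] by simp
  have "(local_rep \<psi> c' e \<circ> (snd c' \<circ> chart_inv c) has_derivative
      fderiv (local_rep \<psi> c' e) (snd c' q) \<circ> coord_change c c' q) (at (snd c q))"
    using diff_chain_at[OF coord_change_derivative[OF A c(1,2) q(1,2)]]
      local_rep_derivative[OF \<psi> c(2,3) q(2,3)] unfolding eq by blast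
  then have "(local_rep \<psi> c e has_derivative
      fderiv (local_rep \<psi> c' e) (snd c' q) \<circ> coord_change c c' q) (at (snd c q))"
  proof (rule has_derivative_transform_within_open)
    show "open (snd c ` (fst c \<inter> fst c'))"
      by (rule chart_image_open[OF A c(1) chart_open(1)[OF A c(2)]])
    show "snd c q \<in> snd c ` (fst c \<inter> fst c')" using q by blast
  qed (use chart_inv(1)[OF A c(1)] chart_inv(1)[OF A c(2)] in auto)
  from fderiv_eqI[OF this] show ?thesis by simp
qed

lemma local_rep_change_target:
  assumes A: "smooth_atlas A" and B: "smooth_atlas B" and \<psi>: "smooth_map A B \<psi>"
    and c: "c \<in> A" "d \<in> B" "d' \<in> B" and q: "q \<in> fst c" "\<psi> q \<in> fst d" "\<psi> q \<in> fst d'"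
  shows "coord_change d d' (\<psi> q) (fderiv (local_rep \<psi> c d) (snd c q) u) = fderiv (local_rep \<psi> c d') (snd c q) u"
proof -
  have eq: "local_rep \<psi> c d (snd c q) = snd d (\<psi> q)"
    using chart_inv(1)[OF A c(1) q(1)] by simp
  have "((snd d' \<circ> chart_inv d) \<circ> local_rep \<psi> c d has_derivative
      coord_change d d' (\<psi> q) \<circ> fderiv (local_rep \<psi> c d) (snd c q)) (at (snd c q))"
    using diff_chain_at[OF local_rep_derivative[OF \<psi> c(1,2) q(1,2)]]
      coord_change_derivative[OF B c(2,3) q(2,3)] unfolding eq by blast
  then have "(local_rep \<psi> c d' has_derivative
      coord_change d d' (\<psi> q) \<circ> fderiv (local_rep \<psi> c d) (snd c q)) (at (snd c q))"
  proof (rule has_derivative_transform_within_open)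
    show "open (snd c ` (fst c \<inter> \<psi> -` fst d))"
      by (rule smooth_map_domain_open[OF A c(1) \<psi> chart_open(1)[OF B c(2)]])
    show "snd c q \<in> snd c ` (fst c \<inter> \<psi> -` fst d)" using q by blast
  qed (use chart_inv(1)[OF A c(1)] chart_inv(1)[OF B c(2)] in auto)
  from fderiv_eqI[OF this] show ?thesis by simp
qed

lemma coord_change_self:
  assumes A: "smooth_atlas A" and c: "c \<in> A" "q \<in> fst c"
  shows "coord_change c c q u = u"
proof -
  have "((\<lambda>x. x) has_derivative (\<lambda>x. x)) (at (snd c q))" by (rule has_derivative_ident)
  then have "(snd c \<circ> chart_inv c has_derivative (\<lambda>x. x)) (at (snd c q))"
    by (rule has_derivative_transform_within_open[OF _ chart_open(2)[OF A c(1)]])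
      (use c chart_inv(3)[OF A c(1)] in auto)
  from fderiv_eqI[OF this] show ?thesis by (simp add: coord_change_def)
qed

text \<open>The change of source chart for the identity map, with \<open>c\<close> as target: the
  representative from \<open>c\<close> to \<open>c\<close> has derivative the identity.\<close>

lemma coord_change_inverse:
  assumes A: "smooth_atlas A" and c: "c \<in> A" "d \<in> A" and q: "q \<in> fst c" "q \<in> fst d"
  shows "coord_change d c q (coord_change c d q u) = u"
  using local_rep_change_source[OF A smooth_map_id[OF A] c(1,2) c(1), of q u] q
    coord_change_self[OF A c(1) q(1)]
  by (simp add: coord_change_def)

lemma metric_in_chart_at:
  assumes "smooth_atlas A"
  shows "metric_in A g (chart_at A p) (snd (chart_at A p) p) = g p"
  by (intro ext) (simp add: metric_in_def Let_def chart_inv(1)[OF assms] chart_at[OF assms]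
      coord_change_self[OF assms])

lemma metric_in_local_metric:
  assumes A: "smooth_atlas A" and g: "smooth_symmetric_tensor A g"
    and nd: "\<And>p u. (\<And>v. g p u v = 0) \<Longrightarrow> u = 0" and c: "c \<in> A"
  shows "local_metric (snd c ` fst c) (metric_in A g c)"
proof
  show "open (snd c ` fst c)" by (rule chart_open(2)[OF A c])
  have bg: "bilinear (g p)" and sym: "g p u v = g p v u" for p u v
    using g by (auto simp: smooth_symmetric_tensor_def)
  show "metric_in A g c y u v = metric_in A g c y v u" for y u v
    by (simp add: metric_in_def Let_def) (rule sym)
  show "Ck_on 2 (snd c ` fst c) (\<lambda>y. metric_in A g c y u v)" for u v
    using g c unfolding smooth_symmetric_tensor_def smooth_on_def by blast
  fix y assume y: "y \<in> snd c ` fst c"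
  define p where "p = chart_inv c y"
  have p: "p \<in> fst c" using chart_inv(2)[OF A c y] by (simp add: p_def)
  let ?t = "coord_change c (chart_at A p) p"
  have m: "metric_in A g c y u v = g p (?t u) (?t v)" for u v
    by (simp add: metric_in_def Let_def p_def)
  have lin: "linear ?t" by (rule coord_change_linear[OF A c chart_at(1)[OF A] p chart_at(2)[OF A]])
  show "bilinear (metric_in A g c y)"
    unfolding bilinear_def
    by (auto intro!: linearI simp: m linear_add[OF lin] linear_cmul[OF lin]
        bilinear_ladd[OF bg] bilinear_radd[OF bg] bilinear_lmul[OF bg] bilinear_rmul[OF bg])
  fix u assume u: "\<And>v. metric_in A g c y u v = 0"
  \<comment> \<open>An arbitrary \<open>w\<close> in the preferred chart is the image under
    \<open>?t\<close> of its components in \<open>c\<close>, to which the hypothesis on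
    \<open>u\<close> applies.\<close>
  have "g p (?t u) w = 0" for w
    using u[of "coord_change (chart_at A p) c p w"]
    by (simp add: m coord_change_inverse[OF A chart_at(1)[OF A] c chart_at(2)[OF A] p])
  then have "?t u = 0" by (rule nd)
  then show "u = 0"
    using coord_change_inverse[OF A c chart_at(1)[OF A] p chart_at(2)[OF A], of u]
      linear_0[OF coord_change_linear[OF A chart_at(1)[OF A] c chart_at(2)[OF A] p]] by simp
qed

section \<open>From a submanifold to its coordinate representation and back\<close>

locale spacelike_immersion =
  fixes A :: "('s::{t2_space,second_countable_topology}, 'd::euclidean_space) chart set"
    and B :: "('m::{t2_space,second_countable_topology}, 'e::euclidean_space) chart set"
    and g :: "('m, 'e) metric" and \<psi> :: "'s \<Rightarrow> 'm"
  assumes B: "smooth_atlas B" and g: "smooth_symmetric_tensor B g"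
    and g_nondeg: "\<And>p u. (\<And>v. g p u v = 0) \<Longrightarrow> u = 0"
    and submanifold: "spacelike_submanifold A B g \<psi>"
begin

abbreviation "h \<equiv> induced_metric A B g \<psi>"
abbreviation "d\<psi> \<equiv> differential A B \<psi>"

lemma A: "smooth_atlas A" and smooth: "smooth_map A B \<psi>"
  and h: "smooth_symmetric_tensor A h" and h_pos: "u \<noteq> 0 \<Longrightarrow> h p u u > 0"
  using submanifold
  by (auto simp: spacelike_submanifold_def immersion_def riemannian_metric_def)

lemma h_nondeg: "(\<And>v. h p u v = 0) \<Longrightarrow> u = 0"
  using h_pos by (metis less_irrefl)

lemma differential_eq:
  "d\<psi> p = fderiv (local_rep \<psi> (chart_at A p) (chart_at B (\<psi> p))) (snd (chart_at A p) p)"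
  by (intro ext) (simp add: differential_def)

text \<open>\<open>d\<psi> q\<close> refers to the preferred charts at \<open>q\<close> and
  \<open>\<psi> q\<close>, which vary with \<open>q\<close>. These formulas express it through one
  fixed pair of charts: the first serves the induced metric, the second the fields along
  \<open>\<psi>\<close>.\<close>

lemma differential_coord_change:
  assumes "c \<in> A" "d \<in> B" "q \<in> fst c" "\<psi> q \<in> fst d"
  shows "d\<psi> q (coord_change c (chart_at A q) q u) =
      coord_change d (chart_at B (\<psi> q)) (\<psi> q) (fderiv (local_rep \<psi> c d) (snd c q) u)"
    and "coord_change (chart_at B (\<psi> q)) d (\<psi> q) (d\<psi> q (coord_change c (chart_at A q) q u)) =
      fderiv (local_rep \<psi> c d) (snd c q) u"
proof -
  note cA = chart_at[OF A, of q] and cB = chart_at[OF B, of "\<psi> q"]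
  have 1: "d\<psi> q (coord_change c (chart_at A q) q u) =
      fderiv (local_rep \<psi> c (chart_at B (\<psi> q))) (snd c q) u"
    unfolding differential_eq
    by (rule local_rep_change_source[OF A smooth assms(1) cA(1) cB(1) assms(3) cA(2) cB(2)])
  show "d\<psi> q (coord_change c (chart_at A q) q u) =
      coord_change d (chart_at B (\<psi> q)) (\<psi> q) (fderiv (local_rep \<psi> c d) (snd c q) u)"
    unfolding 1 by (rule local_rep_change_target[OF A B smooth assms(1,2) cB(1) assms(3,4) cB(2), symmetric])
  show "coord_change (chart_at B (\<psi> q)) d (\<psi> q) (d\<psi> q (coord_change c (chart_at A q) q u)) =
      fderiv (local_rep \<psi> c d) (snd c q) u"
    unfolding 1 by (rule local_rep_change_target[OF A B smooth assms(1) cB(1) assms(2,3) cB(2) assms(4)])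
qed

lemma local_immersion:
  assumes "c \<in> A" "d \<in> B"
  shows "local_immersion (snd c ` (fst c \<inter> \<psi> -` fst d)) (metric_in A h c)
    (snd d ` fst d) (metric_in B g d) (local_rep \<psi> c d)"
proof (intro local_immersion.intro local_immersion_axioms.intro)
  show "local_metric (snd c ` (fst c \<inter> \<psi> -` fst d)) (metric_in A h c)"
    by (rule local_metric_subset[OF metric_in_local_metric[OF A h h_nondeg assms(1)]])
      (auto intro: smooth_map_domain_open[OF A assms(1) smooth] chart_open(1)[OF B assms(2)])
  show "local_metric (snd d ` fst d) (metric_in B g d)"
    by (rule metric_in_local_metric[OF B g g_nondeg assms(2)])
  show "Ck_on 3 (snd c ` (fst c \<inter> \<psi> -` fst d)) (local_rep \<psi> c d)"
    using smooth assms unfolding smooth_map_def smooth_on_def by blast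
  fix x assume "x \<in> snd c ` (fst c \<inter> \<psi> -` fst d)"
  then obtain q where q: "q \<in> fst c" "\<psi> q \<in> fst d" "x = snd c q" by blast
  then have inv: "chart_inv c x = q" using chart_inv(1)[OF A assms(1)] by simp
  show "local_rep \<psi> c d x \<in> snd d ` fst d" using q inv by simp
  show "metric_in A h c x u v =
      metric_in B g d (local_rep \<psi> c d x) (fderiv (local_rep \<psi> c d) x u) (fderiv (local_rep \<psi> c d) x v)" for u v
    using chart_inv(1)[OF B assms(2) q(2)]
    by (simp add: metric_in_def Let_def inv induced_metric_def
        differential_coord_change(1)[OF assms q(1,2)] q(3)[symmetric])
qed

context
  fixes p :: 's
begin

abbreviation "cS \<equiv> chart_at A p"
abbreviation "cM \<equiv> chart_at B (\<psi> p)"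
abbreviation "xS \<equiv> snd cS p"

interpretation loc: local_immersion "snd cS ` (fst cS \<inter> \<psi> -` fst cM)" "metric_in A h cS"
    "snd cM ` fst cM" "metric_in B g cM" "local_rep \<psi> cS cM"
  by (rule local_immersion[OF chart_at(1)[OF A] chart_at(1)[OF B]])

lemma base_point: "xS \<in> snd cS ` (fst cS \<inter> \<psi> -` fst cM)" "local_rep \<psi> cS cM xS = snd cM (\<psi> p)"
  using chart_at[OF A, of p] chart_at[OF B, of "\<psi> p"] chart_inv(1)[OF A] by auto

text \<open>In the fixed charts the chart changes in \<open>coord_extension\<close> and
  \<open>field_in\<close> undo each other, so the field being differentiated is just
  \<open>fderiv (local_rep \<psi> cS cM) y v\<close>.\<close>

lemma cov_deriv_along_eq:
  "cov_deriv_along A B g \<psi> p u (\<lambda>q. d\<psi> q (coord_extension A p v q)) = loc.hess xS u v"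
proof -
  have eq: "field_in B \<psi> cS cM (\<lambda>q. d\<psi> q (coord_extension A p v q)) y = fderiv (local_rep \<psi> cS cM) y v"
    if y: "y \<in> snd cS ` (fst cS \<inter> \<psi> -` fst cM)" for y
  proof -
    obtain q where q: "q \<in> fst cS" "\<psi> q \<in> fst cM" "y = snd cS q" using y by blast
    then have "chart_inv cS y = q" using chart_inv(1)[OF A chart_at(1)[OF A]] by simp
    then show ?thesis
      using differential_coord_change(2)[OF chart_at(1)[OF A] chart_at(1)[OF B] q(1,2)]
      by (simp add: field_in_def coord_extension_def q(3)[symmetric])
  qed
  have "fderiv (field_in B \<psi> cS cM (\<lambda>q. d\<psi> q (coord_extension A p v q))) xS =
      fderiv (\<lambda>y. fderiv (local_rep \<psi> cS cM) y v) xS"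
    by (rule fderiv_eqI, rule has_derivative_transform_within_open[OF loc.df_derivative[OF base_point(1)]
        loc.dom.openV base_point(1)]) (simp add: eq)
  moreover have "coord_extension A p v p = v"
    by (simp add: coord_extension_def coord_change_self[OF A] chart_at[OF A])
  ultimately show ?thesis
    by (simp add: cov_deriv_along_def Let_def loc.hess_def christoffel_eq differential_eq
        base_point(2)[simplified])
qed

lemma g_eq: "metric_in B g cM (local_rep \<psi> cS cM xS) = g (\<psi> p)"
  unfolding base_point(2) by (rule metric_in_chart_at[OF B])

lemma h_eq: "metric_in A h cS xS = h p"
  by (rule metric_in_chart_at[OF A])

lemma g_bilinear: "bilinear (g (\<psi> p))" and g_sym: "g (\<psi> p) u' v' = g (\<psi> p) v' u'"
  using g by (auto simp: smooth_symmetric_tensor_def)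

lemma differential_linear: "linear (d\<psi> p)"
  unfolding differential_eq by (rule loc.df_linear[OF base_point(1)])

lemma second_fundamental_form_eq:
  "second_fundamental_form A B g \<psi> p u v = loc.second_form xS u v"
  unfolding second_fundamental_form_def cov_deriv_along_eq normal_part_def
proof (rule the_equality)
  have n: "loc.second_form xS u v \<in> normal_space A B g \<psi> p"
    using loc.second_form_normal[OF base_point(1)]
    unfolding g_eq differential_eq[symmetric] by (simp add: normal_space_def)
  then show "loc.second_form xS u v \<in> normal_space A B g \<psi> p \<and>
      loc.hess xS u v - loc.second_form xS u v \<in> range (d\<psi> p)"
    by (simp add: loc.second_form_def differential_eq)
  \<comment> \<open>Two candidates for the normal part differ by a vector that is both tangent and
    normal. It is thus the image of some \<open>s\<close> with \<open>h p s s = 0\<close>, and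
    definiteness of \<open>h\<close> makes it vanish.\<close>
  fix z assume z: "z \<in> normal_space A B g \<psi> p \<and> loc.hess xS u v - z \<in> range (d\<psi> p)"
  then obtain t where t: "loc.hess xS u v - z = d\<psi> p t" by blast
  define s where "s = t - levi_civita (metric_in A h cS) xS u v"
  have s: "loc.second_form xS u v - z = d\<psi> p s"
    using t by (simp add: loc.second_form_def differential_eq[symmetric] s_def
        linear_diff[OF differential_linear] algebra_simps)
  have "h p s s = g (\<psi> p) (loc.second_form xS u v - z) (d\<psi> p s)"
    by (simp add: induced_metric_def s)
  also have "\<dots> = 0"
    using n z by (simp add: normal_space_def bilinear_lsub[OF g_bilinear])
  finally have "s = 0" using h_pos by (metis less_irrefl)
  then show "z = loc.second_form xS u v"
    using s linear_0[OF differential_linear] by simp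
qed

lemma second_fundamental_form:
  shows "bilinear (second_fundamental_form A B g \<psi> p)"
    and "second_fundamental_form A B g \<psi> p u v = second_fundamental_form A B g \<psi> p v u"
    and "g (\<psi> p) (second_fundamental_form A B g \<psi> p u v) (d\<psi> p w) = 0"
proof -
  have "second_fundamental_form A B g \<psi> p = loc.second_form xS"
    by (intro ext second_fundamental_form_eq)
  then show "bilinear (second_fundamental_form A B g \<psi> p)"
    and "second_fundamental_form A B g \<psi> p u v = second_fundamental_form A B g \<psi> p v u"
    and "g (\<psi> p) (second_fundamental_form A B g \<psi> p u v) (d\<psi> p w) = 0"
    using loc.second_form_bilinear[OF base_point(1)] loc.second_form_sym[OF base_point(1)]
      loc.second_form_normal[OF base_point(1)] unfolding g_eq differential_eq by simp_all
qed

lemma gauss: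
  "h p (curvature_tensor A h p u v w) z =
    g (\<psi> p) (curvature_tensor B g (\<psi> p) (d\<psi> p u) (d\<psi> p v) (d\<psi> p w)) (d\<psi> p z) +
    g (\<psi> p) (second_fundamental_form A B g \<psi> p v w) (second_fundamental_form A B g \<psi> p u z) -
    g (\<psi> p) (second_fundamental_form A B g \<psi> p u w) (second_fundamental_form A B g \<psi> p v z)"
  using loc.gauss_equation[OF base_point(1), of u v w z]
  unfolding h_eq g_eq unfolding second_fundamental_form_eq curvature_tensor_eq differential_eq base_point(2) .

end

end

section \<open>Orthonormal frames and umbilical normals\<close>

lemma orthogonal_family_span:
  fixes b :: "'e::euclidean_space \<Rightarrow> 'e \<Rightarrow> real"
  assumes b: "bilinear b"
    and orth: "\<And>i j. i < DIM('e) \<Longrightarrow> j < DIM('e) \<Longrightarrow> i \<noteq> j \<Longrightarrow> b (E i) (E j) = 0"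
    and nz: "\<And>i. i < DIM('e) \<Longrightarrow> b (E i) (E i) \<noteq> 0"
  shows "\<exists>a. w = (\<Sum>i<DIM('e). a i *\<^sub>R E i)"
proof -
  let ?I = "{..<DIM('e)}"
  have inj: "inj_on E ?I"
    by (rule inj_onI) (metis orth nz lessThan_iff)
  have coeff: "b (\<Sum>i\<in>?I. a i *\<^sub>R E i) (E j) = a j * b (E j) (E j)" if "j < DIM('e)" for a j
  proof -
    have lin: "linear (\<lambda>u. b u (E j))" using b by (simp add: bilinear_def)
    have "b (\<Sum>i\<in>?I. a i *\<^sub>R E i) (E j) = (\<Sum>i\<in>?I. a i * b (E i) (E j))"
      unfolding linear_sum[OF lin] bilinear_lmul[OF b] by simp
    also have "\<dots> = (\<Sum>i\<in>?I. if i = j then a j * b (E j) (E j) else 0)"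
      by (rule sum.cong) (use orth that in auto)
    finally show ?thesis using that by simp
  qed
  have "independent (E ` ?I)"
  proof (rule independent_if_scalars_zero)
    fix f x assume f: "(\<Sum>x\<in>E ` ?I. f x *\<^sub>R x) = 0" and "x \<in> E ` ?I"
    then obtain j where j: "j < DIM('e)" "x = E j" by auto
    have "(\<Sum>i\<in>?I. f (E i) *\<^sub>R E i) = 0" using f by (simp add: sum.reindex[OF inj])
    then show "f x = 0"
      using coeff[OF j(1), of "\<lambda>i. f (E i)"] nz[OF j(1)] j(2) by (simp add: bilinear_lzero[OF b])
  qed simp
  then have "UNIV \<subseteq> span (E ` ?I)"
    by (intro card_ge_dim_independent) (simp_all add: card_image[OF inj])
  then have "w \<in> span (E ` ?I)" by blast
  then obtain f where "w = (\<Sum>x\<in>E ` ?I. f x *\<^sub>R x)"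
    by (auto simp: span_finite)
  then have "w = (\<Sum>i\<in>?I. f (E i) *\<^sub>R E i)" by (simp add: sum.reindex[OF inj])
  then show ?thesis by (intro exI[of _ "\<lambda>i. f (E i)"])
qed

text \<open>Asking for nonzero squares instead of unit ones covers Lorentzian frames, with one
  square equal to -1, as well as Riemannian ones.\<close>

lemma orthogonal_family_nondegenerate:
  fixes b :: "'e::euclidean_space \<Rightarrow> 'e \<Rightarrow> real"
  assumes b: "bilinear b"
    and orth: "\<And>i j. i < DIM('e) \<Longrightarrow> j < DIM('e) \<Longrightarrow> i \<noteq> j \<Longrightarrow> b (E i) (E j) = 0"
    and nz: "\<And>i. i < DIM('e) \<Longrightarrow> b (E i) (E i) \<noteq> 0"
    and w: "\<And>i. i < DIM('e) \<Longrightarrow> b w (E i) = 0"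
  shows "w = 0"
proof -
  obtain a where a: "w = (\<Sum>i<DIM('e). a i *\<^sub>R E i)"
    using orthogonal_family_span[OF b, of E w] orth nz by auto
  have "a j = 0" if j: "j < DIM('e)" for j
  proof -
    have lin: "linear (\<lambda>u. b u (E j))" using b by (simp add: bilinear_def)
    have "b w (E j) = (\<Sum>i<DIM('e). a i * b (E i) (E j))"
      unfolding a linear_sum[OF lin] bilinear_lmul[OF b] by simp
    also have "\<dots> = (\<Sum>i<DIM('e). if i = j then a j * b (E j) (E j) else 0)"
      by (rule sum.cong) (use orth j in auto)
    finally show ?thesis using w[OF j] nz[OF j] j by simp
  qed
  then show ?thesis by (simp add: a)
qed

locale positive_form =
  fixes h :: "'d::euclidean_space \<Rightarrow> 'd \<Rightarrow> real"
  assumes bil: "bilinear h" and sym: "\<And>u v. h u v = h v u" and pos: "\<And>u. u \<noteq> 0 \<Longrightarrow> h u u > 0"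
begin

text \<open>Gram-Schmidt. Traces and the extrinsic scalar curvature are the \<open>THE\<close> value
  common to all frames, and without any frame every number would qualify.\<close>

lemma orthonormal_frame_exists: "\<exists>E. orthonormal_frame h E"
proof -
  have "\<exists>E. \<forall>i<k. \<forall>j<k. h (E i) (E j) = (if i = j then 1 else 0)" if "k \<le> DIM('d)" for k
    using that
  proof (induction k)
    case (Suc k)
    then obtain E where E: "\<And>i j. i < k \<Longrightarrow> j < k \<Longrightarrow> h (E i) (E j) = (if i = j then 1 else 0)"
      by auto
    have "dim (E ` {..<k}) \<le> card (E ` {..<k})" by (rule dim_le_card') simp
    also have "\<dots> \<le> k" using card_image_le[of "{..<k}" E] by simp
    \<comment> \<open>At most \<open>k\<close> vectors cannot span, since \<open>Suc k\<close> is
      still bounded by the dimension; this leaves room for a further vector.\<close>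
    finally have "span (E ` {..<k}) \<noteq> UNIV" using Suc.prems by (metis dim_UNIV dim_span not_less_eq_eq)
    then obtain v where v: "v \<notin> span (E ` {..<k})" by blast
    define w where "w = v - (\<Sum>i<k. h v (E i) *\<^sub>R E i)"
    have w: "w \<noteq> 0"
    proof
      assume "w = 0"
      then have "v = (\<Sum>i<k. h v (E i) *\<^sub>R E i)" by (simp add: w_def)
      moreover have "(\<Sum>i<k. h v (E i) *\<^sub>R E i) \<in> span (E ` {..<k})"
        by (intro span_sum span_scale span_base) auto
      ultimately show False using v by metis
    qed
    have wE: "h w (E j) = 0" if j: "j < k" for j
    proof -
      have lin: "linear (\<lambda>u. h u (E j))" using bil by (simp add: bilinear_def)
      have "h (\<Sum>i<k. h v (E i) *\<^sub>R E i) (E j) = (\<Sum>i<k. h v (E i) * h (E i) (E j))"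
        unfolding linear_sum[OF lin] bilinear_lmul[OF bil] by simp
      also have "\<dots> = (\<Sum>i<k. if i = j then h v (E j) else 0)"
        by (rule sum.cong) (use E j in auto)
      finally show ?thesis using j by (simp add: w_def bilinear_lsub[OF bil])
    qed
    define e where "e = (1 / sqrt (h w w)) *\<^sub>R w"
    have "h e e = 1"
      using pos[OF w] by (simp add: e_def bilinear_lmul[OF bil] bilinear_rmul[OF bil])
    moreover have "h e (E j) = 0" "h (E j) e = 0" if "j < k" for j
      using wE[OF that] by (simp_all add: e_def bilinear_lmul[OF bil] bilinear_rmul[OF bil] sym[of "E j"])
    ultimately have "\<forall>i<Suc k. \<forall>j<Suc k. h ((E(k := e)) i) ((E(k := e)) j) = (if i = j then 1 else 0)"
      using E by (auto simp: less_Suc_eq)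
    then show ?case by blast
  qed simp
  from this[OF order_refl] show ?thesis by (simp add: orthonormal_frame_def)
qed

lemma frame_expand:
  assumes E: "orthonormal_frame h E"
  shows "v = (\<Sum>i<DIM('d). h v (E i) *\<^sub>R E i)"
proof -
  have "h (v - (\<Sum>i<DIM('d). h v (E i) *\<^sub>R E i)) (E j) = 0" if j: "j < DIM('d)" for j
  proof -
    have lin: "linear (\<lambda>u. h u (E j))" using bil by (simp add: bilinear_def)
    have "h (\<Sum>i<DIM('d). h v (E i) *\<^sub>R E i) (E j) = (\<Sum>i<DIM('d). h v (E i) * h (E i) (E j))"
      unfolding linear_sum[OF lin] bilinear_lmul[OF bil] by simp
    also have "\<dots> = (\<Sum>i<DIM('d). if i = j then h v (E j) else 0)"
      by (rule sum.cong) (use E j in \<open>auto simp: orthonormal_frame_def\<close>)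
    finally show ?thesis using j by (simp add: bilinear_lsub[OF bil])
  qed
  then have "v - (\<Sum>i<DIM('d). h v (E i) *\<^sub>R E i) = 0"
    using E by (intro orthogonal_family_nondegenerate[OF bil, of E]) (auto simp: orthonormal_frame_def)
  then show ?thesis by simp
qed

lemma frame_inner:
  assumes E: "orthonormal_frame h E"
  shows "(\<Sum>i<DIM('d). h u (E i) * h v (E i)) = h u v"
proof -
  have lin: "linear (\<lambda>u. h u v)" using bil by (simp add: bilinear_def)
  have "h u v = h (\<Sum>i<DIM('d). h u (E i) *\<^sub>R E i) v"
    by (subst frame_expand[OF E, of u]) (rule refl)
  also have "\<dots> = (\<Sum>i<DIM('d). h u (E i) * h (E i) v)"
    unfolding linear_sum[OF lin] bilinear_lmul[OF bil] by simp
  finally show ?thesis by (simp add: sym[of v])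
qed

lemma metric_trace_eqI:
  assumes "\<And>E. orthonormal_frame h E \<Longrightarrow> (\<Sum>i<DIM('d). b (E i) (E i)) = t"
  shows "metric_trace h b = t"
  unfolding metric_trace_def using assms orthonormal_frame_exists by (intro the_equality) auto

text \<open>Expanding one frame in the other and summing over the first turns the coefficients into
  \<open>h (E i) (E k)\<close> by Parseval's identity \<open>frame_inner\<close>.\<close>

lemma metric_trace:
  assumes b: "bilinear b" and E: "orthonormal_frame h E"
  shows "metric_trace h b = (\<Sum>i<DIM('d). b (E i) (E i))"
proof (rule metric_trace_eqI)
  fix E' assume E': "orthonormal_frame h E'"
  let ?I = "{..<DIM('d)}"
  have "b (E' j) (E' j) = (\<Sum>i\<in>?I. \<Sum>k\<in>?I. (h (E' j) (E i) * h (E' j) (E k)) *\<^sub>R b (E i) (E k))" for j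
  proof -
    have "b (E' j) (E' j) = b (\<Sum>i\<in>?I. h (E' j) (E i) *\<^sub>R E i) (\<Sum>i\<in>?I. h (E' j) (E i) *\<^sub>R E i)"
      by (simp flip: frame_expand[OF E])
    also have "\<dots> = (\<Sum>i\<in>?I. \<Sum>k\<in>?I. b (h (E' j) (E i) *\<^sub>R E i) (h (E' j) (E k) *\<^sub>R E k))"
      by (simp add: bilinear_sum[OF b] sum.cartesian_product)
    finally show ?thesis by (simp add: bilinear_lmul[OF b] bilinear_rmul[OF b] mult.commute)
  qed
  then have "(\<Sum>j\<in>?I. b (E' j) (E' j)) =
      (\<Sum>j\<in>?I. \<Sum>i\<in>?I. \<Sum>k\<in>?I. (h (E' j) (E i) * h (E' j) (E k)) *\<^sub>R b (E i) (E k))" by simp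
  also have "\<dots> = (\<Sum>i\<in>?I. \<Sum>j\<in>?I. \<Sum>k\<in>?I. (h (E' j) (E i) * h (E' j) (E k)) *\<^sub>R b (E i) (E k))"
    by (rule sum.swap)
  also have "\<dots> = (\<Sum>i\<in>?I. \<Sum>k\<in>?I. \<Sum>j\<in>?I. (h (E' j) (E i) * h (E' j) (E k)) *\<^sub>R b (E i) (E k))"
    by (intro sum.cong refl sum.swap)
  also have "\<dots> = (\<Sum>i\<in>?I. \<Sum>k\<in>?I. h (E i) (E k) *\<^sub>R b (E i) (E k))"
  proof (intro sum.cong refl)
    fix i k
    have "(\<Sum>j\<in>?I. h (E' j) (E i) * h (E' j) (E k)) = h (E i) (E k)"
      unfolding frame_inner[OF E', of "E i" "E k", symmetric] by (intro sum.cong refl arg_cong2[of _ _ _ _ "(*)"] sym)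
    then show "(\<Sum>j\<in>?I. (h (E' j) (E i) * h (E' j) (E k)) *\<^sub>R b (E i) (E k)) = h (E i) (E k) *\<^sub>R b (E i) (E k)"
      by (simp flip: scaleR_sum_left)
  qed
  also have "\<dots> = (\<Sum>i\<in>?I. \<Sum>k\<in>?I. if i = k then b (E i) (E i) else 0)"
    by (intro sum.cong refl) (use E in \<open>auto simp: orthonormal_frame_def\<close>)
  finally show "(\<Sum>j\<in>?I. b (E' j) (E' j)) = (\<Sum>i\<in>?I. b (E i) (E i))" by simp
qed

text \<open>Bridges \<open>ricci_tensor\<close>, a trace over the Euclidean \<open>Basis\<close>,
  and sums over \<open>h\<close>-orthonormal frames: the trace of an endomorphism depends on no
  inner product.\<close>

lemma trace_frame:
  assumes L: "linear L" and E: "orthonormal_frame h E"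
  shows "(\<Sum>b\<in>Basis. L b \<bullet> b) = (\<Sum>i<DIM('d). h (L (E i)) (E i))"
proof -
  let ?I = "{..<DIM('d)}"
  have "L b \<bullet> b = (\<Sum>i\<in>?I. h b (E i) * (L (E i) \<bullet> b))" for b
  proof -
    have "L b = L (\<Sum>i\<in>?I. h b (E i) *\<^sub>R E i)" by (simp flip: frame_expand[OF E])
    also have "\<dots> = (\<Sum>i\<in>?I. h b (E i) *\<^sub>R L (E i))"
      unfolding linear_sum[OF L] linear_cmul[OF L] ..
    finally have "L b \<bullet> b = (\<Sum>i\<in>?I. h b (E i) *\<^sub>R L (E i)) \<bullet> b" by (rule arg_cong)
    then show ?thesis by (simp only: inner_sum_left inner_scaleR_left)
  qed
  then have "(\<Sum>b\<in>Basis. L b \<bullet> b) = (\<Sum>b\<in>Basis. \<Sum>i\<in>?I. h b (E i) * (L (E i) \<bullet> b))"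
    by (rule sum.cong[OF refl])
  also have "\<dots> = (\<Sum>i\<in>?I. \<Sum>b\<in>Basis. h b (E i) * (L (E i) \<bullet> b))" by (rule sum.swap)
  also have "\<dots> = (\<Sum>i\<in>?I. h (L (E i)) (E i))"
  proof (rule sum.cong[OF refl])
    fix i
    have "linear (\<lambda>u. h u (E i))" using bil by (simp add: bilinear_def)
    from linear_expand[OF this, of "L (E i)"]
    show "(\<Sum>b\<in>Basis. h b (E i) * (L (E i) \<bullet> b)) = h (L (E i)) (E i)"
      by (simp add: mult.commute)
  qed
  finally show ?thesis .
qed

end

section \<open>Null normals in codimension two and the algebra of umbilicity\<close>

lemma null_normal_line:
  fixes b :: "'e::euclidean_space \<Rightarrow> 'e \<Rightarrow> real" and F :: "'d::euclidean_space \<Rightarrow> 'e"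
  assumes b: "bilinear b" and nondeg: "\<And>u. (\<And>v. b u v = 0) \<Longrightarrow> u = 0"
    and F: "linear F" and pos: "\<And>u. u \<noteq> 0 \<Longrightarrow> b (F u) (F u) > 0"
    and dim: "DIM('e) = DIM('d) + 2"
    and \<xi>: "\<And>u. b \<xi> (F u) = 0" "b \<xi> \<xi> = 0" "\<xi> \<noteq> 0"
    and w: "\<And>u. b w (F u) = 0" "b \<xi> w = 0"
  shows "\<exists>a. w = a *\<^sub>R \<xi>"
proof (rule ccontr)
  assume no: "\<not> (\<exists>a. w = a *\<^sub>R \<xi>)"
  have F0: "F u = 0 \<longleftrightarrow> u = 0" for u
    using pos[of u] linear_0[OF F] bilinear_lzero[OF b] by (cases "u = 0") auto
  have sp: "span (range F) = range F"
    using linear_subspace_image[OF F subspace_UNIV] by (simp add: span_eq_iff)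
  have normal: "z = 0" if z: "z \<in> range F" "\<And>u. b z (F u) = 0" for z
  proof -
    obtain u where u: "z = F u" using z(1) by blast
    have "b (F u) (F u) = 0" using z(2)[of u] unfolding u .
    then show ?thesis using pos[of u] F0[of u] u by auto
  qed
  have "dim (range F) = DIM('d)"
    using dim_image_eq[OF F, of UNIV] F0 by (simp add: linear_injective_0[OF F])
  moreover have "\<xi> \<notin> span (range F)"
    using normal[OF _ \<xi>(1)] \<xi>(3) unfolding sp by blast
  moreover have "w \<notin> span (insert \<xi> (range F))"
  proof
    assume "w \<in> span (insert \<xi> (range F))"
    then obtain k where "w - k *\<^sub>R \<xi> \<in> range F"
      unfolding span_breakdown_eq sp by blast
    moreover have "b (w - k *\<^sub>R \<xi>) (F u) = 0" for u
      by (simp add: bilinear_lsub[OF b] bilinear_lmul[OF b] w \<xi>)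
    ultimately have "w - k *\<^sub>R \<xi> = 0" by (rule normal)
    then show False using no by auto
  qed
  ultimately have "dim (insert w (insert \<xi> (range F))) = DIM('e)"
    by (simp add: dim_insert dim)
  then have full: "span (insert w (insert \<xi> (range F))) = UNIV"
    by (simp add: dim_eq_full)
  \<comment> \<open>If \<open>w\<close> were off the line of \<open>\<xi>\<close>, then
    \<open>range F\<close>, \<open>\<xi>\<close> and \<open>w\<close> would span everything. All
    three are orthogonal to \<open>\<xi>\<close>, the second because \<open>\<xi>\<close> is
    null.\<close>
  have "b \<xi> v = 0" for v
  proof -
    have lin: "linear (b \<xi>)" using b by (simp add: bilinear_def)
    show ?thesis
      by (rule linear_eq_0_on_span[OF lin, of "insert w (insert \<xi> (range F))"])
        (use full w \<xi> in auto)
  qed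
  then have "\<xi> = 0" by (rule nondeg)
  then show False using \<xi>(3) by simp
qed

lemma umbilical_gauss_sum:
  fixes b :: "'e::euclidean_space \<Rightarrow> 'e \<Rightarrow> real" and F :: "'d::euclidean_space \<Rightarrow> 'e"
    and Q :: "'d \<Rightarrow> 'd \<Rightarrow> 'e"
  defines "n \<equiv> DIM('d)"
  assumes b: "bilinear b" and sym: "\<And>u v. b u v = b v u"
    and nondeg: "\<And>u. (\<And>v. b u v = 0) \<Longrightarrow> u = 0"
    and F: "linear F" and pos: "\<And>u. u \<noteq> 0 \<Longrightarrow> b (F u) (F u) > 0"
    and dim: "DIM('e) = DIM('d) + 2"
    and \<xi>: "\<And>u. b \<xi> (F u) = 0" "b \<xi> \<xi> = 0" "\<xi> \<noteq> 0"
    and Q: "\<And>u v w. b (Q u v) (F w) = 0" "\<And>u v. b (Q u v) \<xi> = \<rho> * b (F u) (F v)"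
    and E: "\<And>i j. i < n \<Longrightarrow> j < n \<Longrightarrow> b (F (E i)) (F (E j)) = (if i = j then 1 else 0)"
    and H: "H = (1 / real n) *\<^sub>R (\<Sum>i<n. Q (E i) (E i))"
  shows "(\<Sum>i<n. \<Sum>j<n. b (Q (E j) (E j)) (Q (E i) (E i)) - b (Q (E i) (E j)) (Q (E i) (E j))) =
    real n * (real n - 1) * b H H"
proof -
  have n: "n > 0" by (simp add: n_def)
  have lin: "linear (\<lambda>u. b u v)" "linear (b v)" for v using b by (simp_all add: bilinear_def)
  have bH: "b H v = (1 / real n) * (\<Sum>i<n. b (Q (E i) (E i)) v)" for v
    unfolding H bilinear_lmul[OF b] linear_sum[OF lin(1)] by simp
  have HF: "b H (F u) = 0" for u by (simp add: bH Q)
  have H\<xi>: "b H \<xi> = \<rho>" using n by (simp add: bH Q E)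
  have nH: "(\<Sum>i<n. Q (E i) (E i)) = real n *\<^sub>R H" using n by (simp add: H)
  \<comment> \<open>Pairing \<open>Q u v\<close> with \<open>\<xi>\<close> gives
    \<open>\<rho> * b (F u) (F v)\<close>, and \<open>b H \<xi> = \<rho>\<close>. Subtracting this
    multiple of \<open>H\<close> therefore leaves a normal vector orthogonal to
    \<open>\<xi>\<close>.\<close>
  have "\<exists>a. Q u v - b (F u) (F v) *\<^sub>R H = a *\<^sub>R \<xi>" for u v
  proof (rule null_normal_line[OF b nondeg F pos dim \<xi>])
    show "b (Q u v - b (F u) (F v) *\<^sub>R H) (F w) = 0" for w
      by (simp add: bilinear_lsub[OF b] bilinear_lmul[OF b] Q HF)
    show "b \<xi> (Q u v - b (F u) (F v) *\<^sub>R H) = 0"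
      by (subst sym) (simp add: bilinear_lsub[OF b] bilinear_lmul[OF b] Q H\<xi>)
  qed
  then obtain a where a: "\<And>u v. Q u v - b (F u) (F v) *\<^sub>R H = a u v *\<^sub>R \<xi>"
    by metis
  have Qa: "Q (E i) (E j) = (if i = j then H else 0) + a (E i) (E j) *\<^sub>R \<xi>" if "i < n" "j < n" for i j
    using a[of "E i" "E j"] E[OF that] by (auto simp: algebra_simps)
  have "(\<Sum>i<n. a (E i) (E i)) *\<^sub>R \<xi> = (\<Sum>i<n. Q (E i) (E i) - H)"
    unfolding scaleR_sum_left by (rule sum.cong) (auto simp: Qa)
  also have "\<dots> = 0" by (simp add: sum_subtractf nH sum_constant_scaleR)
  finally have tr: "(\<Sum>i<n. a (E i) (E i)) = 0" using \<xi>(3) by simp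
  have "(\<Sum>i<n. \<Sum>j<n. b (Q (E j) (E j)) (Q (E i) (E i))) =
      b (\<Sum>j<n. Q (E j) (E j)) (\<Sum>i<n. Q (E i) (E i))"
    unfolding linear_sum[OF lin(1)] linear_sum[OF lin(2)] ..
  also have "\<dots> = (real n)\<^sup>2 * b H H"
    unfolding nH by (simp add: bilinear_lmul[OF b] bilinear_rmul[OF b] power2_eq_square)
  finally have 1: "(\<Sum>i<n. \<Sum>j<n. b (Q (E j) (E j)) (Q (E i) (E i))) = (real n)\<^sup>2 * b H H" .
  \<comment> \<open>Off the diagonal \<open>Q (E i) (E j)\<close> is a multiple of the null vector
    \<open>\<xi>\<close> and has zero square. On the diagonal the mixed terms with \<open>H\<close>
    give \<open>2 * \<rho> * a (E i) (E i)\<close>, which the trace condition removes.\<close>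
  have "(\<Sum>i<n. \<Sum>j<n. b (Q (E i) (E j)) (Q (E i) (E j))) =
      (\<Sum>i<n. \<Sum>j<n. if i = j then b H H + 2 * \<rho> * a (E i) (E i) else 0)"
    using H\<xi> sym[of \<xi> H] \<xi>(2)
    by (intro sum.cong refl) (auto simp: Qa bilinear_ladd[OF b] bilinear_radd[OF b]
        bilinear_lmul[OF b] bilinear_rmul[OF b] bilinear_lzero[OF b] bilinear_rzero[OF b] algebra_simps)
  also have "\<dots> = real n * b H H + 2 * \<rho> * (\<Sum>i<n. a (E i) (E i))"
    by (simp add: sum.distrib sum_distrib_left)
  finally have 2: "(\<Sum>i<n. \<Sum>j<n. b (Q (E i) (E j)) (Q (E i) (E j))) = real n * b H H"
    by (simp add: tr)
  show ?thesis
    unfolding sum_subtractf 1 2 by (simp add: power2_eq_square algebra_simps)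
qed

lemma sum_off_diagonal:
  fixes f :: "nat \<Rightarrow> nat \<Rightarrow> real"
  assumes "\<And>i j. f i j = f j i" "\<And>i. f i i = 0"
  shows "(\<Sum>i<n. \<Sum>j<n. f i j) = 2 * (\<Sum>j<n. \<Sum>i<j. f i j)"
proof (induction n)
  case (Suc n)
  have "(\<Sum>i<n. f n i) = (\<Sum>i<n. f i n)" using assms by simp
  with Suc assms(2) show ?case by (simp add: sum.distrib)
qed simp

section \<open>Curvature of umbilical spacelike submanifolds\<close>

text \<open>The \<open>THE\<close> ranges over all pairs spanning the plane. Existence is
  \<open>sectional_well_defined\<close>; uniqueness follows by instantiating with \<open>u\<close>,
  \<open>v\<close> itself.\<close>

lemma sectional_curvature_eq:
  assumes A: "smooth_atlas A" and g: "smooth_symmetric_tensor A g"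
    and nd: "\<And>p u. (\<And>v. g p u v = 0) \<Longrightarrow> u = 0"
    and gram: "gram (g p) u v \<noteq> 0"
  shows "sectional_curvature A g p (span {u, v}) =
    g p (curvature_tensor A g p u v v) u / gram (g p) u v"
proof -
  interpret local_metric "snd (chart_at A p) ` fst (chart_at A p)" "metric_in A g (chart_at A p)"
    by (rule metric_in_local_metric[OF A g nd chart_at(1)[OF A]])
  have x: "snd (chart_at A p) p \<in> snd (chart_at A p) ` fst (chart_at A p)"
    using chart_at(2)[OF A] by (rule imageI)
  note wd = sectional_well_defined[OF x, unfolded metric_in_chart_at[OF A], OF gram]
  show ?thesis
    unfolding sectional_curvature_def gram_def[symmetric] curvature_tensor_eq
  proof (rule the_equality)
    show "\<forall>u' v'. span {u', v'} = span {u, v} \<longrightarrow>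
      g p (R (snd (chart_at A p) p) u v v) u / gram (g p) u v =
      g p (R (snd (chart_at A p) p) u' v' v') u' / gram (g p) u' v'"
      using wd by (metis (no_types, lifting))
  qed blast
qed

text \<open>\<open>constant_sectional_curvature\<close> speaks only of nondegenerate planes of
  dimension two; this qualifies the planes spanned by frame vectors.\<close>

lemma orthonormal_pair_plane:
  fixes b :: "'e::euclidean_space \<Rightarrow> 'e \<Rightarrow> real"
  assumes b: "bilinear b" and sym: "\<And>u v. b u v = b v u"
    and uv: "b u u = 1" "b v v = 1" "b u v = 0"
  shows "tangent_plane (span {u, v})" and "nondegenerate_on b (span {u, v})"
proof -
  have comb: "b (p *\<^sub>R u + q *\<^sub>R v) u = p" "b (p *\<^sub>R u + q *\<^sub>R v) v = q" for p q
    using uv sym[of v u] by (simp_all add: bilinear_ladd[OF b] bilinear_lmul[OF b])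
  have ne: "u \<noteq> v" using uv by auto
  have "independent {u, v}"
  proof (rule independent_if_scalars_zero)
    fix f x assume "(\<Sum>x\<in>{u, v}. f x *\<^sub>R x) = 0" and x: "x \<in> {u, v}"
    then have "f u *\<^sub>R u + f v *\<^sub>R v = 0" using ne by simp
    then have "f u = 0" "f v = 0"
      using comb[of "f u" "f v"] by (metis bilinear_lzero[OF b])+
    then show "f x = 0" using x by auto
  qed simp
  then show "tangent_plane (span {u, v})"
    using ne by (simp add: tangent_plane_def dim_eq_card_independent)
  show "nondegenerate_on b (span {u, v})"
    unfolding nondegenerate_on_def
  proof (intro ballI impI)
    fix w assume "w \<in> span {u, v}" and w: "\<forall>z\<in>span {u, v}. b w z = 0"
    then obtain p q where pq: "w = p *\<^sub>R u + q *\<^sub>R v"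
      by (auto simp: span_insert span_singleton diff_eq_eq add.commute)
    have "b w u = 0" "b w v = 0" using w by (auto intro: span_base)
    then show "w = 0" using comb[of p q] by (simp add: pq)
  qed
qed

lemma lorentzian_metric_nondegenerate:
  fixes g :: "('m, 'e::euclidean_space) metric"
  assumes g: "lorentzian_metric B g" and u: "\<And>v. g p u v = 0"
  shows "u = 0"
proof -
  obtain E :: "nat \<Rightarrow> 'e" where E: "\<forall>i<DIM('e). \<forall>j<DIM('e).
      g p (E i) (E j) = (if i \<noteq> j then 0 else if i = 0 then -1 else 1)"
    using g unfolding lorentzian_metric_def by blast
  have "bilinear (g p)" using g by (simp add: lorentzian_metric_def smooth_symmetric_tensor_def)
  then show ?thesis
    by (rule orthogonal_family_nondegenerate[where E=E]) (use E u in auto)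
qed

context spacelike_immersion
begin

abbreviation "II \<equiv> second_fundamental_form A B g \<psi>"
abbreviation "H \<equiv> mean_curvature A B g \<psi>"

lemma h_form: "positive_form (h p)"
  using h h_pos by unfold_locales (auto simp: smooth_symmetric_tensor_def)

text \<open>Converts umbilicity, stated through a \<open>THE\<close>, into the identity g(II(u,v),
  \<xi>) = \<rho> h(u,v) on which the algebra operates.\<close>

lemma shape_operator:
  "h p (shape_operator A B g \<psi> \<zeta> p u) v = g (\<psi> p) (II p u v) (\<zeta> p)"
proof -
  interpret positive_form "h p" by (rule h_form)
  have "linear (\<lambda>v. g (\<psi> p) (II p u v) (\<zeta> p))"
    by (rule linearI) (simp_all add: bilinear_radd[OF second_fundamental_form(1)]
      bilinear_rmul[OF second_fundamental_form(1)] bilinear_ladd[OF g_bilinear] bilinear_lmul[OF g_bilinear])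
  then obtain w where w: "\<And>v. h p w v = g (\<psi> p) (II p u v) (\<zeta> p)"
    using nondegenerate_represents[OF bil sym h_nondeg[of p]] by blast
  have "shape_operator A B g \<psi> \<zeta> p u = w"
    unfolding shape_operator_def
  proof (rule the_equality)
    fix w' assume "\<forall>v. h p w' v = g (\<psi> p) (II p u v) (\<zeta> p)"
    then have "h p (w' - w) v = 0" for v by (simp add: bilinear_lsub[OF bil] w)
    then have "w' - w = 0" by (rule h_nondeg)
    then show "w' = w" by simp
  qed (simp add: w)
  then show ?thesis by (simp add: w)
qed

lemma ambient_curvature_orthonormal_pair:
  assumes "h p u u = 1" "h p v v = 1" "h p u v = 0"
  shows "sectional_curvature B g (\<psi> p) (d\<psi> p ` span {u, v}) =
    g (\<psi> p) (curvature_tensor B g (\<psi> p) (d\<psi> p u) (d\<psi> p v) (d\<psi> p v)) (d\<psi> p u)"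
proof -
  have "d\<psi> p ` span {u, v} = span {d\<psi> p u, d\<psi> p v}"
    using linear_span_image[OF differential_linear[of p], of "{u, v}"] by simp
  moreover have "gram (g (\<psi> p)) (d\<psi> p u) (d\<psi> p v) = 1"
    using assms by (simp add: gram_def induced_metric_def)
  moreover have "sectional_curvature B g (\<psi> p) (span {d\<psi> p u, d\<psi> p v}) =
      g (\<psi> p) (curvature_tensor B g (\<psi> p) (d\<psi> p u) (d\<psi> p v) (d\<psi> p v)) (d\<psi> p u) /
      gram (g (\<psi> p)) (d\<psi> p u) (d\<psi> p v)"
    by (rule sectional_curvature_eq[OF B g]) (use calculation in \<open>auto intro: g_nondeg\<close>)
  ultimately show ?thesis by simp
qed

text \<open>Both Gram determinants equal 1, so the Gauss equation applies without denominators and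
  the ambient curvature cancels.\<close>

lemma discriminant_orthonormal_pair:
  assumes "h p u u = 1" "h p v v = 1" "h p u v = 0"
  shows "discriminant A B g \<psi> p (span {u, v}) =
    g (\<psi> p) (II p v v) (II p u u) - g (\<psi> p) (II p u v) (II p u v)"
proof -
  have gram: "gram (h p) u v = 1" using assms by (simp add: gram_def)
  have "sectional_curvature A h p (span {u, v}) =
      h p (curvature_tensor A h p u v v) u / gram (h p) u v"
    by (rule sectional_curvature_eq[OF A h]) (auto intro: h_nondeg simp: gram)
  then have "sectional_curvature A h p (span {u, v}) = h p (curvature_tensor A h p u v v) u"
    by (simp add: gram)
  then show ?thesis
    unfolding discriminant_def ambient_curvature_orthonormal_pair[OF assms]
    by (simp add: gauss second_fundamental_form(2)[of p v u])
qed

lemma gauss_sum_frame: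
  assumes dim: "DIM('e) = DIM('d) + 2" and \<xi>: "umbilical_lightlike_section A B g \<psi> \<xi>"
    and E: "orthonormal_frame (h p) E"
  shows "(\<Sum>i<DIM('d). \<Sum>j<DIM('d). g (\<psi> p) (II p (E j) (E j)) (II p (E i) (E i)) -
      g (\<psi> p) (II p (E i) (E j)) (II p (E i) (E j))) =
    real DIM('d) * (real DIM('d) - 1) * g (\<psi> p) (H p) (H p)"
proof -
  interpret positive_form "h p" by (rule h_form)
  obtain \<rho> where \<rho>: "\<And>p u. shape_operator A B g \<psi> \<xi> p u = \<rho> p *\<^sub>R u"
    using \<xi> unfolding umbilical_lightlike_section_def by blast
  show ?thesis
  proof (rule umbilical_gauss_sum[where F="d\<psi> p" and \<xi>="\<xi> p" and \<rho>="\<rho> p",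
        OF g_bilinear g_sym g_nondeg differential_linear _ dim])
    show "u \<noteq> 0 \<Longrightarrow> g (\<psi> p) (d\<psi> p u) (d\<psi> p u) > 0" for u
      using h_pos[of u p] by (simp add: induced_metric_def)
    show "g (\<psi> p) (\<xi> p) (d\<psi> p u) = 0" "g (\<psi> p) (\<xi> p) (\<xi> p) = 0" "\<xi> p \<noteq> 0" for u
      using \<xi> by (auto simp: umbilical_lightlike_section_def normal_space_def)
    show "g (\<psi> p) (II p u v) (d\<psi> p w) = 0" for u v w
      by (rule second_fundamental_form(3))
    show "g (\<psi> p) (II p u v) (\<xi> p) = \<rho> p * g (\<psi> p) (d\<psi> p u) (d\<psi> p v)" for u v
      using shape_operator[of p \<xi> u v]
      by (simp add: \<rho> bilinear_lmul[OF bil]) (simp add: induced_metric_def)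
    show "i < DIM('d) \<Longrightarrow> j < DIM('d) \<Longrightarrow>
        g (\<psi> p) (d\<psi> p (E i)) (d\<psi> p (E j)) = (if i = j then 1 else 0)" for i j
      using E by (simp add: orthonormal_frame_def induced_metric_def)
    show "H p = (1 / real DIM('d)) *\<^sub>R (\<Sum>i<DIM('d). II p (E i) (E i))"
      unfolding mean_curvature_def metric_trace[OF second_fundamental_form(1) E] ..
  qed
qed

lemma extrinsic_scalar_curvature_umbilical:
  assumes dim: "DIM('e) = DIM('d) + 2" "DIM('d) \<ge> 2"
    and \<xi>: "umbilical_lightlike_section A B g \<psi> \<xi>"
  shows "extrinsic_scalar_curvature A B g \<psi> p = g (\<psi> p) (H p) (H p)"
proof -
  interpret positive_form "h p" by (rule h_form)
  let ?n = "real DIM('d)"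
  have val: "2 / (?n * (?n - 1)) * (\<Sum>j<DIM('d). \<Sum>i<j. discriminant A B g \<psi> p (span {E i, E j})) =
      g (\<psi> p) (H p) (H p)" if E: "orthonormal_frame (h p) E" for E
  proof -
    define f where "f = (\<lambda>i j. g (\<psi> p) (II p (E j) (E j)) (II p (E i) (E i)) -
      g (\<psi> p) (II p (E i) (E j)) (II p (E i) (E j)))"
    have "(\<Sum>j<DIM('d). \<Sum>i<j. discriminant A B g \<psi> p (span {E i, E j})) =
        (\<Sum>j<DIM('d). \<Sum>i<j. f i j)"
      unfolding f_def
      by (intro sum.cong refl discriminant_orthonormal_pair)
        (use E in \<open>auto simp: orthonormal_frame_def\<close>)
    moreover have "(\<Sum>i<DIM('d). \<Sum>j<DIM('d). f i j) = 2 * (\<Sum>j<DIM('d). \<Sum>i<j. f i j)"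
    proof (rule sum_off_diagonal)
      show "f i j = f j i" for i j
        unfolding f_def second_fundamental_form(2)[of p "E i" "E j"]
          g_sym[of p "II p (E j) (E j)" "II p (E i) (E i)"] ..
    qed (simp add: f_def)
    moreover have "(\<Sum>i<DIM('d). \<Sum>j<DIM('d). f i j) = ?n * (?n - 1) * g (\<psi> p) (H p) (H p)"
      unfolding f_def by (rule gauss_sum_frame[OF dim(1) \<xi> E])
    \<comment> \<open>Dimension at least two makes n(n-1) nonzero, so the normalising factor can be
      cancelled.\<close>
    ultimately show ?thesis using dim(2) by (simp add: field_simps)
  qed
  obtain E where E: "orthonormal_frame (h p) E" using orthonormal_frame_exists by blast
  show ?thesis
    unfolding extrinsic_scalar_curvature_def
  proof (rule the_equality)
    fix t assume "\<forall>E. orthonormal_frame (h p) E \<longrightarrow>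
      t = 2 / (?n * (?n - 1)) * (\<Sum>j<DIM('d). \<Sum>i<j. discriminant A B g \<psi> p (span {E i, E j}))"
    then show "t = g (\<psi> p) (H p) (H p)" using val[OF E] E by simp
  qed (use val[symmetric] in blast)
qed

text \<open>The frame sum of the Ricci tensor takes the same explicit value on every frame, which is
  all that \<open>metric_trace_eqI\<close> asks for.\<close>

lemma scalar_curvature_umbilical:
  assumes dim: "DIM('e) = DIM('d) + 2"
    and \<xi>: "umbilical_lightlike_section A B g \<psi> \<xi>"
    and const: "constant_sectional_curvature B g k"
  shows "scalar_curvature A h p =
    real DIM('d) * (real DIM('d) - 1) * (k + g (\<psi> p) (H p) (H p))"
  unfolding scalar_curvature_def
proof (rule positive_form.metric_trace_eqI[OF h_form])
  interpret form: positive_form "h p" by (rule h_form)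
  fix E assume E: "orthonormal_frame (h p) E"
  let ?I = "{..<DIM('d)}" and ?n = "real DIM('d)"
  let ?R = "curvature_tensor A h p"
  define f where "f = (\<lambda>i j. g (\<psi> p) (II p (E j) (E j)) (II p (E i) (E i)) -
      g (\<psi> p) (II p (E i) (E j)) (II p (E i) (E j)))"
  have alt: "curvature_tensor A' g' q u u w = 0"
    for A' :: "('x, 'y::euclidean_space) chart set" and g' q u w
    by (simp add: curvature_tensor_def Let_def)
  have lin: "linear (\<lambda>u. ?R u v w)" for v w
  proof -
    interpret local_metric "snd (chart_at A p) ` fst (chart_at A p)" "metric_in A h (chart_at A p)"
      by (rule metric_in_local_metric[OF A h h_nondeg chart_at(1)[OF A]])
    have "snd (chart_at A p) p \<in> snd (chart_at A p) ` fst (chart_at A p)"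
      using chart_at(2)[OF A] by (rule imageI)
    from riemann_bilinear[OF this] show ?thesis
      by (simp add: curvature_tensor_eq bilinear_def)
  qed
  \<comment> \<open>On the diagonal the curvature vanishes by alternation and so does
    \<open>f i i\<close>. Hence \<open>k\<close> is counted n^2 - n times in the double sum.\<close>
  have entry: "h p (?R (E i) (E j) (E j)) (E i) = (if i = j then 0 else k) + f i j"
    if "i \<in> ?I" "j \<in> ?I" for i j
  proof (cases "i = j")
    case True
    then show ?thesis by (simp add: alt f_def bilinear_lzero[OF form.bil])
  next
    case False
    then have o: "h p (E i) (E i) = 1" "h p (E j) (E j) = 1" "h p (E i) (E j) = 0"
      using E that by (auto simp: orthonormal_frame_def)
    have "d\<psi> p ` span {E i, E j} = span {d\<psi> p (E i), d\<psi> p (E j)}"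
      using linear_span_image[OF differential_linear[of p], of "{E i, E j}"] by simp
    then have "sectional_curvature B g (\<psi> p) (d\<psi> p ` span {E i, E j}) = k"
      using const orthonormal_pair_plane[OF g_bilinear g_sym o[unfolded induced_metric_def]]
      unfolding constant_sectional_curvature_def by simp
    then show ?thesis
      using False unfolding ambient_curvature_orthonormal_pair[OF o]
      by (simp add: gauss f_def second_fundamental_form(2)[of p "E j" "E i"])
  qed
  have "(\<Sum>j\<in>?I. ricci_tensor A h p (E j) (E j)) = (\<Sum>j\<in>?I. \<Sum>i\<in>?I. h p (?R (E i) (E j) (E j)) (E i))"
    unfolding ricci_tensor_def by (intro sum.cong refl form.trace_frame lin E)
  also have "\<dots> = (\<Sum>i\<in>?I. \<Sum>j\<in>?I. h p (?R (E i) (E j) (E j)) (E i))" by (rule sum.swap)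
  also have "\<dots> = (\<Sum>i\<in>?I. \<Sum>j\<in>?I. k - (if i = j then k else 0) + f i j)"
    by (intro sum.cong refl) (auto simp: entry)
  also have "\<dots> = ?n * (?n - 1) * k + (\<Sum>i\<in>?I. \<Sum>j\<in>?I. f i j)"
    by (simp add: sum.distrib sum_subtractf algebra_simps)
  also have "(\<Sum>i\<in>?I. \<Sum>j\<in>?I. f i j) = ?n * (?n - 1) * g (\<psi> p) (H p) (H p)"
    unfolding f_def by (rule gauss_sum_frame[OF dim \<xi> E])
  finally show "(\<Sum>j\<in>?I. ricci_tensor A h p (E j) (E j)) = ?n * (?n - 1) * (k + g (\<psi> p) (H p) (H p))"
    by (simp add: algebra_simps)
qed

end

theorem proposition4p1:
  fixes A :: "('s::{t2_space,second_countable_topology}, 'd::euclidean_space) chart set"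
    and B :: "('m::{t2_space,second_countable_topology}, 'e::euclidean_space) chart set"
    and g :: "('m, 'e) metric" and T :: "'m \<Rightarrow> 'e" and \<psi> :: "'s \<Rightarrow> 'm" and n :: nat
  assumes "spacetime B g T"
    and "DIM('e) = n + 2" and "n + 2 \<ge> 4"
    and "spacelike_submanifold A B g \<psi>" and "DIM('d) = n"
    and "\<exists>\<xi>. umbilical_lightlike_section A B g \<psi> \<xi>"
  shows "(\<forall>p. extrinsic_scalar_curvature A B g \<psi> p =
             g (\<psi> p) (mean_curvature A B g \<psi> p) (mean_curvature A B g \<psi> p)) \<and>
         (\<forall>c. constant_sectional_curvature B g c \<longrightarrow>
           (\<forall>p. scalar_curvature A (induced_metric A B g \<psi>) p =
             real n * (real n - 1) *
             (c + g (\<psi> p) (mean_curvature A B g \<psi> p) (mean_curvature A B g \<psi> p))))"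
proof -
  have lor: "lorentzian_metric B g" and B: "smooth_atlas B"
    using assms(1) by (auto simp: spacetime_def)
  interpret spacelike_immersion A B g \<psi>
    using B lor assms(4) lorentzian_metric_nondegenerate[OF lor]
    by unfold_locales (auto simp: lorentzian_metric_def)
  obtain \<xi> where \<xi>: "umbilical_lightlike_section A B g \<psi> \<xi>" using assms(6) by blast
  have dim: "DIM('e) = DIM('d) + 2" "DIM('d) \<ge> 2" using assms(2,3,5) by auto
  show ?thesis
    using extrinsic_scalar_curvature_umbilical[OF dim \<xi>] scalar_curvature_umbilical[OF dim(1) \<xi>]
      assms(5) by simp
qed

end
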